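(* Let $N\ge 3$, let $M$ be a symmetric positive definite real $N\times N$ matrix, and let $H(\xi)=\sqrt{\langle M\xi,\xi\rangle}$ for $\xi\in\mathbb{R}^N$. Let $g\in L^{\frac{N}{N-1}}_{loc}(\mathbb{R}^N)$ and let $u\in W^{1,N}_{loc}(\mathbb{R}^N)$ be a locally bounded weak solution of $-\Delta^H_N u=g$ in $\mathbb{R}^N$. Define $T_H(y)=\frac{\nabla H(y)}{H(y)}$ for $y\in\mathbb{R}^N\setminus\{0\}$ and $u^*=u\circ T_H$. Then $u^*$ is a weak solution of the dual equation $$-\Delta^{H^\circ}_N u^*=\frac{g\circ T_H}{H^{2N}}\qquad\text{in }\mathbb{R}^N\setminus\{0\},$$ where $H^\circ$ is the dual norm of $H$.
   Context: $\langle\cdot,\cdot\rangle$ is the Euclidean inner product on $\mathbb{R}^N$. The dual norm of $H$ is $H^\circ(x)=\sup\{\langle \xi,x\rangle : H(\xi)\le 1\}$; for $H(\xi)=\sqrt{\langle M\xi,\xi\rangle}$ one has $H^\circ(x)=\sqrt{\langle M^{-1}x,x\rangle}$. For a norm $K\in C^2(\mathbb{R}^N\setminus\{0\})$, the Finsler $N$-Laplacian is $\Delta^K_N v=\operatorname{div}(K^{N-1}(\nabla v)\nabla K(\nabla v))$, where $K^{N-1}(\eta)\nabla K(\eta)$ is understood to be $0$ at $\eta=0$. Given an open set $\Omega\subseteq\mathbb{R}^N$ and $h\in L^{\frac{N}{N-1}}_{loc}(\Omega)$, a function $v\in W^{1,N}_{loc}(\Omega)$ is a weak solution of $-\Delta^K_N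 v=h$ in $\Omega$ if $$\int_\Omega K^{N-1}(\nabla v)\langle\nabla K(\nabla v),\nabla\varphi\rangle\,dx=\int_\Omega h\,\varphi\,dx\qquad\forall\,\varphi\in C^1_c(\Omega).$$ *)

theory Defs
  imports "HOL-Analysis.Analysis"
begin

definition grad :: "('a::euclidean_space \<Rightarrow> real) \<Rightarrow> 'a \<Rightarrow> 'a"
  where "grad f x = (THE D. GDERIV f x :> D)"

text \<open>Functions stand for their classes modulo null sets. The class \<open>Lp_loc p \<Omega>\<close> consists of the
  functions that are Lebesgue measurable on \<open>\<Omega>\<close> with \<open>p\<close>-th power integrable on every compact
  subset of \<open>\<Omega>\<close>.\<close>

definition Lp_loc :: "real \<Rightarrow> 'a::euclidean_space set \<Rightarrow> ('a \<Rightarrow> 'b::euclidean_space) set"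
  where "Lp_loc p \<Omega> =
    {f. f \<in> borel_measurable (lebesgue_on \<Omega>) \<and>
        (\<forall>C. compact C \<and> C \<subseteq> \<Omega> \<longrightarrow> set_integrable lebesgue C (\<lambda>x. norm (f x) powr p))}"

text \<open>Boundedness is essential boundedness, as appropriate for classes modulo null sets.\<close>

definition locally_bounded :: "'a::euclidean_space set \<Rightarrow> ('a \<Rightarrow> real) \<Rightarrow> bool"
  where "locally_bounded \<Omega> f \<longleftrightarrow>
    (\<forall>C. compact C \<and> C \<subseteq> \<Omega> \<longrightarrow> (\<exists>B. AE x in lebesgue. x \<in> C \<longrightarrow> \<bar>f x\<bar> \<le> B))"

text \<open>A function in \<open>C\<^sup>1\<^sub>c(\<Omega>)\<close> is represented by its extension by zero to the whole space, which is
  again continuously differentiable.\<close>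

definition C1_compact_support :: "'a::euclidean_space set \<Rightarrow> ('a \<Rightarrow> real) set"
  where "C1_compact_support \<Omega> =
    {\<phi>. (\<forall>x. \<phi> differentiable (at x)) \<and> continuous_on UNIV (grad \<phi>) \<and>
        compact (closure {x. \<phi> x \<noteq> 0}) \<and> closure {x. \<phi> x \<noteq> 0} \<subseteq> \<Omega>}"

definition has_weak_gradient ::
    "'a::euclidean_space set \<Rightarrow> ('a \<Rightarrow> real) \<Rightarrow> ('a \<Rightarrow> 'a) \<Rightarrow> bool"
  where "has_weak_gradient \<Omega> v G \<longleftrightarrow>
    v \<in> Lp_loc 1 \<Omega> \<and> G \<in> Lp_loc 1 \<Omega> \<and>
    (\<forall>\<phi> \<in> C1_compact_support \<Omega>.
       (LINT x:\<Omega>|lebesgue. v x *\<^sub>R grad \<phi> x) = - (LINT x:\<Omega>|lebesgue. \<phi> x *\<^sub>R G x))"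

definition W1p_loc :: "real \<Rightarrow> 'a::euclidean_space set \<Rightarrow> ('a \<Rightarrow> real) set"
  where "W1p_loc p \<Omega> =
    {v. v \<in> Lp_loc p \<Omega> \<and> (\<exists>G. has_weak_gradient \<Omega> v G \<and> G \<in> Lp_loc p \<Omega>)}"

definition dual_norm :: "('a::euclidean_space \<Rightarrow> real) \<Rightarrow> 'a \<Rightarrow> real"
  where "dual_norm H x = Sup {\<xi> \<bullet> x | \<xi>. H \<xi> \<le> 1}"

text \<open>The vector field \<open>K\<^sup>N\<^sup>-\<^sup>1 \<nabla>K\<close>, extended by zero to the origin, where \<open>K\<close> is not differentiable.\<close>

definition finsler_flux :: "(real^'n \<Rightarrow> real) \<Rightarrow> real^'n \<Rightarrow> real^'n"
  where "finsler_flux K \<eta> = (if \<eta> = 0 then 0 else K \<eta> ^ (CARD('n) - 1) *\<^sub>R grad K \<eta>)"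

text \<open>\<open>weak_solution K \<Omega> h v\<close>: \<open>v\<close> is a weak solution of \<open>-\<Delta>\<^sup>K\<^sub>N v = h\<close> in \<open>\<Omega>\<close>, where \<open>N\<close> is the dimension.
  The standing requirements on \<open>\<Omega>\<close>, \<open>h\<close> and \<open>v\<close> are part of the predicate. The notion is intended for
  norms \<open>K\<close> of class \<open>C\<^sup>2\<close> away from the origin. The weak gradient is unique
  up to null sets, so that the choice of \<open>G\<close> is immaterial.\<close>

definition weak_solution ::
    "(real^'n \<Rightarrow> real) \<Rightarrow> (real^'n) set \<Rightarrow> (real^'n \<Rightarrow> real) \<Rightarrow> (real^'n \<Rightarrow> real) \<Rightarrow> bool"
  where "weak_solution K \<Omega> h v \<longleftrightarrow>
    open \<Omega> \<and>
    h \<in> Lp_loc (real CARD('n) / (real CARD('n) - 1)) \<Omega> \<and>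
    v \<in> W1p_loc (real CARD('n)) \<Omega> \<and>
    (\<exists>G. has_weak_gradient \<Omega> v G \<and> G \<in> Lp_loc (real CARD('n)) \<Omega> \<and>
      (\<forall>\<phi> \<in> C1_compact_support \<Omega>.
         (LINT x:\<Omega>|lebesgue. finsler_flux K (G x) \<bullet> grad \<phi> x)
           = (LINT x:\<Omega>|lebesgue. h x * \<phi> x)))"

definition T_map :: "('a::euclidean_space \<Rightarrow> real) \<Rightarrow> 'a \<Rightarrow> 'a"
  where "T_map H y = grad H y /\<^sub>R H y"

end

(* The map T y = M y / q y, with q y = <M y, y>, is the inversion of the quadratic form q followed
   by M. Its derivative DT is symmetric and satisfies the conformality relation
   <M^-1 (DT y v), DT y w> = <M v, w> / q(y)^2, so |det DT| = |det M| / q^N and the flux of the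
   dual norm paired with transported gradients picks up exactly the factor 1 / q^N. Hence the weak
   formulation for u turns into the one for u o T by the change of variables x = T y, the test
   functions being transported by the inverse map, which is the T of the dual norm.

   The chain rule for the weak gradient needs no mollification: after the change of variables the
   e-component tests u against the divergence of psi W, where W(T y) = q(y)^N DT y e is the
   Jacobian-weighted transport of the constant field e. This field is divergence free (Piola
   identity), so the components psi W_j are admissible test functions for u itself. *)

theory Submission
  imports Defs
begin

section \<open>Change of variables for arbitrary finite index types\<close>

text \<open>The library proves the change of variables theorem only for well-ordered index types; it is
  transported along a copy of the index type that carries a well-order.\<close>

typedef 'n ordered_copy = "UNIV :: 'n::finite set"
  by blast

instantiation ordered_copy :: (finite) "{finite, wellorder}"
begin

text \<open>A finite type is countable, so \<open>to_nat\<close> is injective on it; the order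
  pulled back from the naturals is therefore linear and well-founded.\<close>

definition less_eq_ordered_copy :: "'a ordered_copy \<Rightarrow> 'a ordered_copy \<Rightarrow> bool"
  where "i \<le> j \<longleftrightarrow> to_nat (Rep_ordered_copy i) \<le> to_nat (Rep_ordered_copy j)"

definition less_ordered_copy :: "'a ordered_copy \<Rightarrow> 'a ordered_copy \<Rightarrow> bool"
  where "i < j \<longleftrightarrow> to_nat (Rep_ordered_copy i) < to_nat (Rep_ordered_copy j)"

instance
proof
  have "UNIV = range (Abs_ordered_copy :: 'a \<Rightarrow> _)"
    by (metis Rep_ordered_copy_inverse surjI)
  then show "finite (UNIV :: 'a ordered_copy set)"
    by (metis finite finite_imageI)
next
  fix P :: "'a ordered_copy \<Rightarrow> bool" and a
  assume step: "\<And>i. (\<And>j. j < i \<Longrightarrow> P j) \<Longrightarrow> P i"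
  show "P a"
    by (induction a rule: measure_induct_rule[where f = "\<lambda>i. to_nat (Rep_ordered_copy i)"])
      (rule step, simp add: less_ordered_copy_def)
qed (auto simp: less_eq_ordered_copy_def less_ordered_copy_def Rep_ordered_copy_inject)

end

section \<open>Relabelling of coordinates and Lebesgue measure\<close>

definition from_copy :: "'a ^ 'n ordered_copy \<Rightarrow> 'a ^ 'n"
  where "from_copy x = (\<chi> i. x $ Abs_ordered_copy i)"

definition to_copy :: "'a ^ 'n \<Rightarrow> 'a ^ 'n ordered_copy"
  where "to_copy x = (\<chi> i. x $ Rep_ordered_copy i)"

lemma bij_Rep_ordered_copy: "bij Rep_ordered_copy"
  by (metis Abs_ordered_copy_inverse Rep_ordered_copy_inverse UNIV_I bijI')

lemma to_copy_from_copy [simp]: "to_copy (from_copy x) = x"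
  by (simp add: to_copy_def from_copy_def Rep_ordered_copy_inverse)

lemma from_copy_to_copy [simp]: "from_copy (to_copy x) = x"
  by (simp add: to_copy_def from_copy_def Abs_ordered_copy_inverse)

lemma linear_to_copy: "linear (to_copy :: real ^ 'n \<Rightarrow> _)"
  by (rule linearI) (simp_all add: to_copy_def vec_eq_iff)

lemma linear_from_copy: "linear (from_copy :: real ^ 'n::finite ordered_copy \<Rightarrow> _)"
  by (rule linearI) (simp_all add: from_copy_def vec_eq_iff)

lemma from_copy_vimage_eq: "from_copy -` S = to_copy ` S"
  by (force simp: image_iff)

lemma prod_Basis_vec: "(\<Prod>b\<in>Basis. x \<bullet> b) = (\<Prod>i\<in>UNIV. x $ i)" for x :: "real ^ 'n::finite"
proof -
  have "(\<Prod>i\<in>UNIV. x $ i) = (\<Prod>i\<in>UNIV. x \<bullet> axis i 1)"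
    by (simp add: inner_axis)
  also have "\<dots> = (\<Prod>b\<in>range (\<lambda>i. axis i 1). x \<bullet> b)"
    by (subst prod.reindex) (auto simp: inj_on_def axis_eq_axis)
  also have "range (\<lambda>i. axis i (1::real)) = (Basis :: (real^'n) set)"
    by (auto simp: Basis_vec_def)
  finally show ?thesis ..
qed

text \<open>\<open>lborel\<close> is determined by its values on boxes, and relabelling only
  permutes the side lengths whose product is the volume.\<close>

lemma lborel_eq_distr_from_copy:
  "(lborel :: (real ^ 'n::finite) measure) = distr lborel borel from_copy"
proof (rule lborel_eqI)
  have meas: "(from_copy :: _ \<Rightarrow> real ^ 'n) \<in> borel_measurable borel"
    using linear_from_copy by (intro borel_measurable_continuous_onI linear_continuous_on) (simp add: linear_conv_bounded_linear)
  fix l u :: "real ^ 'n"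
  assume le: "\<And>b. b \<in> Basis \<Longrightarrow> l \<bullet> b \<le> u \<bullet> b"
  have le': "l $ i \<le> u $ i" for i
    using le[of "axis i 1"] by (simp add: inner_axis axis_in_Basis_iff)
  have vim: "from_copy -` box l u = box (to_copy l) (to_copy u)"
    by (auto simp: mem_box_cart from_copy_def to_copy_def)
      (metis Abs_ordered_copy_inverse Rep_ordered_copy_inverse UNIV_I)+
  have "emeasure (distr lborel borel from_copy) (box l u)
      = emeasure lborel (box (to_copy l) (to_copy u))"
    using meas by (subst emeasure_distr) (auto simp: vim)
  also have "\<dots> = (\<Prod>b\<in>Basis. (to_copy u - to_copy l) \<bullet> b)"
    by (rule emeasure_lborel_box) (auto simp: Basis_vec_def inner_axis to_copy_def le')
  also have "\<dots> = (\<Prod>i\<in>UNIV. u $ Rep_ordered_copy i - l $ Rep_ordered_copy i)"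
    by (simp add: prod_Basis_vec to_copy_def)
  also have "\<dots> = (\<Prod>i\<in>UNIV. u $ i - l $ i)"
    using prod.reindex_bij_betw[OF bij_Rep_ordered_copy, of "\<lambda>i. u $ i - l $ i"] by simp
  also have "\<dots> = (\<Prod>b\<in>Basis. (u - l) \<bullet> b)"
    by (simp add: prod_Basis_vec)
  finally show "emeasure (distr lborel borel from_copy) (box l u) = (\<Prod>b\<in>Basis. (u - l) \<bullet> b)" .
qed simp

text \<open>The Borel identity passes to the completions: the image of \<open>lebesgue\<close> on
  Borel sets is \<open>lborel\<close>, so \<open>from_copy\<close> pulls null sets back to null
  sets.\<close>

lemma measurable_from_copy: "(from_copy :: _ \<Rightarrow> real ^ 'n::finite) \<in> lebesgue \<rightarrow>\<^sub>M lebesgue"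
  and lebesgue_eq_distr_from_copy:
    "(lebesgue :: (real ^ 'n::finite) measure) = distr lebesgue lebesgue from_copy"
proof -
  have "continuous_on UNIV (from_copy :: _ \<Rightarrow> real ^ 'n)"
    using linear_from_copy by (intro linear_continuous_on) (simp add: linear_conv_bounded_linear)
  then have meas: "(from_copy :: _ \<Rightarrow> real ^ 'n) \<in> lborel \<rightarrow>\<^sub>M borel"
    by (simp add: borel_measurable_continuous_onI)
  have eq: "distr lebesgue lborel from_copy = (lborel :: (real ^ 'n) measure)"
    by (metis distr_completion lborel_eq_distr_from_copy meas distr_cong sets_lborel measurable_lborel2)
  have meas': "(from_copy :: _ \<Rightarrow> real ^ 'n) \<in> lebesgue \<rightarrow>\<^sub>M lborel"
    using meas by (simp add: measurable_completion)
  show "(from_copy :: _ \<Rightarrow> real ^ 'n) \<in> lebesgue \<rightarrow>\<^sub>M lebesgue"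
    by (rule completion.measurable_completion2[OF meas']) (simp add: eq)
  show "(lebesgue :: (real ^ 'n) measure) = distr lebesgue lebesgue from_copy"
    using completion.completion_distr_eq[OF meas'] by (simp add: eq)
qed

text \<open>A preimage under \<open>to_copy\<close> is an image under its linear inverse, and
  differentiable maps between spaces of equal dimension preserve Lebesgue measurable sets.\<close>

lemma measurable_to_copy: "(to_copy :: real ^ 'n::finite \<Rightarrow> _) \<in> lebesgue \<rightarrow>\<^sub>M lebesgue"
proof (rule measurableI)
  fix A :: "(real ^ 'n ordered_copy) set"
  assume A: "A \<in> sets lebesgue"
  have "CARD('n ordered_copy) = CARD('n)"
    using bij_betw_same_card[OF bij_Rep_ordered_copy] .
  moreover have "from_copy differentiable_on A"
    by (intro linear_imp_differentiable_on linear_from_copy)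
  moreover have "to_copy -` A = from_copy ` A"
    by (force simp: image_iff)
  ultimately show "to_copy -` A \<inter> space lebesgue \<in> sets lebesgue"
    using A by (simp add: differentiable_image_in_sets_lebesgue)
qed simp

lemma
  fixes f :: "real ^ 'n::finite \<Rightarrow> real"
  shows integrable_from_copy:
      "integrable lebesgue (\<lambda>x. f (from_copy x)) \<longleftrightarrow> integrable lebesgue f" (is ?I)
    and integral_from_copy:
      "(LINT x|lebesgue. f (from_copy x)) = (LINT x|lebesgue. f x)" (is ?E)
proof -
  have iff: "integrable lebesgue (\<lambda>x. f (from_copy x)) \<longleftrightarrow> integrable lebesgue f"
    if "f \<in> borel_measurable lebesgue"
    using integrable_distr_eq[OF measurable_from_copy that]
    by (simp flip: lebesgue_eq_distr_from_copy)
  \<comment> \<open>Measurability of \<open>f\<close> is recovered by composing with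
    \<open>to_copy\<close>, so the equivalence holds for arbitrary \<open>f\<close>.\<close>
  have "f \<in> borel_measurable lebesgue" if "(\<lambda>x. f (from_copy x)) \<in> borel_measurable lebesgue"
    using measurable_compose[OF measurable_to_copy that] by simp
  then show ?I
    using iff borel_measurable_integrable by blast
  show ?E
  proof (cases "integrable lebesgue f")
    case True
    then show ?thesis
      using integral_distr[OF measurable_from_copy, of f]
      by (simp flip: lebesgue_eq_distr_from_copy)
  next
    \<comment> \<open>Integrability fails on both sides, and both integrals take the default value
      0.\<close>
    case False
    then show ?thesis
      using \<open>?I\<close> by (simp add: not_integrable_integral_eq)
  qed
qed

lemma
  fixes f :: "real ^ 'n::finite \<Rightarrow> real"
  shows set_integrable_from_copy:
      "set_integrable lebesgue (to_copy ` S) (\<lambda>x. f (from_copy x)) \<longleftrightarrow> set_integrable lebesgue S f"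
    and set_integral_from_copy:
      "(LINT x:to_copy ` S|lebesgue. f (from_copy x)) = (LINT x:S|lebesgue. f x)"
proof -
  have ind: "indicator (to_copy ` S) x = (indicator S (from_copy x) :: real)" for x
    by (auto simp: indicator_def simp flip: from_copy_vimage_eq)
  show "set_integrable lebesgue (to_copy ` S) (\<lambda>x. f (from_copy x)) \<longleftrightarrow> set_integrable lebesgue S f"
    unfolding set_integrable_def ind
    by (rule integrable_from_copy[of "\<lambda>x. indicator S x *\<^sub>R f x"])
  show "(LINT x:to_copy ` S|lebesgue. f (from_copy x)) = (LINT x:S|lebesgue. f x)"
    unfolding set_lebesgue_integral_def ind
    by (rule integral_from_copy[of "\<lambda>x. indicator S x *\<^sub>R f x"])
qed

text \<open>Conjugation by the bijection of the index sets maps permutations onto permutations and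
  preserves signs, so the Leibniz sums agree term by term.\<close>

lemma det_reindex_copy:
  fixes A :: "real ^ 'n ^ 'n"
  shows "det (\<chi> i j. A $ Rep_ordered_copy i $ Rep_ordered_copy j) = det A"
proof -
  let ?R = "Rep_ordered_copy :: 'n ordered_copy \<Rightarrow> 'n"
  let ?m = "map_permutation UNIV ?R"
  have inj: "inj ?R"
    using bij_Rep_ordered_copy by (auto simp: bij_def)
  have bij: "bij_betw ?m {p. p permutes UNIV} {p. p permutes UNIV}"
  proof (rule bij_betw_byWitness[where f' = "map_permutation UNIV Abs_ordered_copy"])
    have "bij (Abs_ordered_copy :: 'n \<Rightarrow> _)"
      by (metis Abs_ordered_copy_inverse Rep_ordered_copy_inverse UNIV_I bijI')
    then show "\<forall>q\<in>{q. q permutes UNIV}. ?m (map_permutation UNIV Abs_ordered_copy q) = q"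
      and "map_permutation UNIV Abs_ordered_copy ` {q. q permutes (UNIV :: 'n set)} \<subseteq> {p. p permutes UNIV}"
      by (auto intro!: map_permutation_compose_inv map_permutation_permutes simp: Abs_ordered_copy_inverse)
  qed (auto intro!: map_permutation_compose_inv map_permutation_permutes bij_Rep_ordered_copy
         simp: Rep_ordered_copy_inverse)
  have app: "?m p (?R i) = ?R (p i)" for p i
    using map_permutation_apply[of ?R UNIV i p] inj by simp
  have "(\<Sum>p | p permutes UNIV. of_int (sign p) * (\<Prod>i\<in>UNIV. A $ i $ p i))
     = (\<Sum>p | p permutes UNIV. of_int (sign (?m p)) * (\<Prod>i\<in>UNIV. A $ i $ ?m p i))"
    by (rule sum.reindex_bij_betw[OF bij, symmetric])
  also have "\<dots> = (\<Sum>p | p permutes UNIV. of_int (sign p) * (\<Prod>i\<in>UNIV. A $ ?R i $ ?R (p i)))"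
  proof (rule sum.cong[OF refl])
    fix p :: "'n ordered_copy \<Rightarrow> 'n ordered_copy"
    assume "p \<in> {p. p permutes UNIV}"
    then have "sign (?m p) = sign p"
      using inj by (intro sign_map_permutation) auto
    moreover have "(\<Prod>i\<in>UNIV. A $ i $ ?m p i) = (\<Prod>i\<in>UNIV. A $ ?R i $ ?R (p i))"
      using prod.reindex_bij_betw[OF bij_Rep_ordered_copy, of "\<lambda>i. A $ i $ ?m p i"] app by simp
    ultimately show "of_int (sign (?m p)) * (\<Prod>i\<in>UNIV. A $ i $ ?m p i)
        = (of_int (sign p) * (\<Prod>i\<in>UNIV. A $ ?R i $ ?R (p i)) :: real)"
      by simp
  qed
  finally show ?thesis
    by (simp add: det_def)
qed

text \<open>The map is conjugated by the relabelling, which changes neither the integrals nor the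
  Jacobian determinant.\<close>

lemma
  fixes f :: "real ^ 'n::finite \<Rightarrow> real" and T :: "real ^ 'n \<Rightarrow> real ^ 'n"
  assumes S: "S \<in> sets lebesgue"
    and der: "\<And>x. x \<in> S \<Longrightarrow> (T has_derivative T' x) (at x within S)"
    and inj: "inj_on T S"
  shows set_integrable_change_of_variables:
      "set_integrable lebesgue S (\<lambda>x. \<bar>det (matrix (T' x))\<bar> * f (T x)) \<longleftrightarrow> set_integrable lebesgue (T ` S) f" (is ?I)
    and lebesgue_integral_change_of_variables:
      "(LINT x:S|lebesgue. \<bar>det (matrix (T' x))\<bar> * f (T x)) = (LINT x:T ` S|lebesgue. f x)" (is ?E)
proof -
  let ?S = "to_copy ` S"
  define t where "t = to_copy \<circ> T \<circ> from_copy"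
  define t' where "t' x = to_copy \<circ> T' (from_copy x) \<circ> from_copy" for x
  have S': "?S \<in> sets lebesgue"
    using measurable_sets[OF measurable_from_copy S] by (simp add: from_copy_vimage_eq)
  have tS: "t ` ?S = to_copy ` (T ` S)"
    by (auto simp: t_def image_image)
  have t_der: "(t has_derivative t' x) (at x within ?S)" if "x \<in> ?S" for x
  proof -
    have "from_copy x \<in> S"
      using that by auto
    have fr: "(from_copy has_derivative from_copy) (at x within ?S)"
      by (intro linear_imp_has_derivative linear_from_copy)
    have "from_copy ` ?S = S"
      by force
    then have "(T \<circ> from_copy has_derivative T' (from_copy x) \<circ> from_copy) (at x within ?S)"
      using der[OF \<open>from_copy x \<in> S\<close>] by (intro diff_chain_within[OF fr]) simp
    then show ?thesis
      unfolding t_def t'_def comp_assoc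
      by (rule diff_chain_within) (intro linear_imp_has_derivative linear_to_copy)
  qed
  have t_inj: "inj_on t ?S"
    using inj unfolding t_def inj_on_def by simp (metis from_copy_to_copy)
  have t_det: "det (matrix (t' x)) = det (matrix (T' (from_copy x)))" if "x \<in> ?S" for x
  proof -
    have "from_copy (axis j 1) = (axis (Rep_ordered_copy j) 1 :: real ^ 'n)" for j :: "'n ordered_copy"
      by (auto simp: from_copy_def axis_def vec_eq_iff Rep_ordered_copy_inverse Abs_ordered_copy_inverse)
    then have "matrix (t' x) = (\<chi> i j. matrix (T' (from_copy x)) $ Rep_ordered_copy i $ Rep_ordered_copy j)"
      by (simp add: matrix_def t'_def to_copy_def)
    then show ?thesis
      by (simp add: det_reindex_copy)
  qed
  let ?D = "\<lambda>x. \<bar>det (matrix (T' x))\<bar> * f (T x)"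
  \<comment> \<open>The library theorem couples integrability with a prescribed value
    \<open>b\<close> and speaks of functions into \<open>real ^ 1\<close>, hence the detour through
    \<open>vec\<close>.\<close>
  have iff: "set_integrable lebesgue ?S (\<lambda>x. ?D (from_copy x)) \<and> integral ?S (\<lambda>x. ?D (from_copy x)) = b
     \<longleftrightarrow> set_integrable lebesgue (t ` ?S) (\<lambda>x. f (from_copy x)) \<and> integral (t ` ?S) (\<lambda>x. f (from_copy x)) = b" for b
  proof -
    let ?f = "\<lambda>x. vec (f (from_copy x)) :: real ^ 1"
    have int: "set_integrable lebesgue ?S (\<lambda>x. ?D (from_copy x))
        \<longleftrightarrow> set_integrable lebesgue ?S (\<lambda>x. \<bar>det (matrix (t' x))\<bar> * f (from_copy (t x)))"
      using t_det by (intro set_integrable_cong) (auto simp: t_def)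
    have eq: "integral ?S (\<lambda>x. ?D (from_copy x))
        = integral ?S (\<lambda>x. \<bar>det (matrix (t' x))\<bar> * f (from_copy (t x)))"
      using t_det by (intro integral_cong) (auto simp: t_def)
    show ?thesis
      using has_absolute_integral_change_of_variables[OF S' t_der t_inj, of ?f "vec b"]
      unfolding int eq by (simp add: absolutely_integrable_on_1_iff integral_on_1_eq vec_eq_iff)
  qed
  \<comment> \<open>Taking for \<open>b\<close> the actual value of either integral separates
    integrability from the value.\<close>
  have "set_integrable lebesgue ?S (\<lambda>x. ?D (from_copy x))
      \<longleftrightarrow> set_integrable lebesgue (t ` ?S) (\<lambda>x. f (from_copy x))"
    using iff[of "integral ?S (\<lambda>x. ?D (from_copy x))"] iff[of "integral (t ` ?S) (\<lambda>x. f (from_copy x))"]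
    by auto
  then show ?I
    unfolding tS set_integrable_from_copy set_integrable_from_copy[where f = ?D] .
  show ?E
  proof (cases "set_integrable lebesgue (T ` S) f")
    case True
    then have f: "set_integrable lebesgue (t ` ?S) (\<lambda>x. f (from_copy x))"
      unfolding tS set_integrable_from_copy .
    then have D: "set_integrable lebesgue ?S (\<lambda>x. ?D (from_copy x))"
      and eq: "integral ?S (\<lambda>x. ?D (from_copy x)) = integral (t ` ?S) (\<lambda>x. f (from_copy x))"
      using iff[of "integral (t ` ?S) (\<lambda>x. f (from_copy x))"] by auto
    have "(LINT x:?S|lebesgue. ?D (from_copy x)) = (LINT x:t ` ?S|lebesgue. f (from_copy x))"
      using set_lebesgue_integral_eq_integral(2)[OF D] set_lebesgue_integral_eq_integral(2)[OF f] eq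
      by simp
    then show ?thesis
      unfolding tS set_integral_from_copy set_integral_from_copy[where f = ?D] .
  next
    \<comment> \<open>As integrability fails on both sides, both integrals are 0 by default.\<close>
    case False
    then show ?thesis
      using \<open>?I\<close> unfolding set_lebesgue_integral_def set_integrable_def
      by (simp add: not_integrable_integral_eq)
  qed
qed

section \<open>Quadratic norms\<close>

lemma grad_eq:
  assumes "GDERIV f x :> D"
  shows "grad f x = D"
  unfolding grad_def
proof (rule the_equality)
  fix D' assume "GDERIV f x :> D'"
  with assms have "(\<lambda>h. h \<bullet> D') = (\<lambda>h. h \<bullet> D)"
    unfolding gderiv_def by (rule has_derivative_unique[rotated])
  then show "D' = D"
    by (metis vector_eq_ldot)
qed (rule assms)

definition quad_norm :: "real ^ 'n ^ 'n \<Rightarrow> real ^ 'n \<Rightarrow> real"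
  where "quad_norm A x = sqrt ((A *v x) \<bullet> x)"

locale pos_def_matrix =
  fixes A :: "real ^ 'n ^ 'n"
  assumes sym: "transpose A = A"
    and pos: "\<And>x. x \<noteq> 0 \<Longrightarrow> (A *v x) \<bullet> x > 0"
begin

definition q :: "real ^ 'n \<Rightarrow> real"
  where "q x = (A *v x) \<bullet> x"

definition T :: "real ^ 'n \<Rightarrow> real ^ 'n"
  where "T x = (A *v x) /\<^sub>R q x"

text \<open>At the origin division by zero makes this the zero map, so that \<open>DT_conj\<close>
  and \<open>finsler_flux_DT\<close> hold there as well.\<close>

definition DT :: "real ^ 'n \<Rightarrow> real ^ 'n \<Rightarrow> real ^ 'n"
  where "DT x v = (A *v v) /\<^sub>R q x - (2 * ((A *v x) \<bullet> v) / (q x)\<^sup>2) *\<^sub>R (A *v x)"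

lemma sym_inner: "(A *v x) \<bullet> y = x \<bullet> (A *v y)"
  by (metis dot_lmul_matrix sym transpose_matrix_vector)

lemma q_0 [simp]: "q 0 = 0"
  by (simp add: q_def)

lemma q_scaleR: "q (c *\<^sub>R x) = c\<^sup>2 * q x"
  by (simp add: q_def matrix_vector_mult_scaleR power2_eq_square)

lemma q_diff: "q (x - y) = q x - 2 * ((A *v x) \<bullet> y) + q y"
  using sym_inner[of x y] inner_commute[of "A *v y" x]
  by (simp add: q_def matrix_vector_mult_diff_distrib inner_diff_left inner_diff_right)

lemma q_pos: "x \<noteq> 0 \<Longrightarrow> q x > 0"
  using pos by (simp add: q_def)

lemma q_nonneg: "q x \<ge> 0"
  using q_pos[of x] by (cases "x = 0") (auto simp: q_def)

lemma q_eq_0_iff [simp]: "q x = 0 \<longleftrightarrow> x = 0"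
  using q_pos[of x] by (cases "x = 0") (auto simp: q_def)

lemma quad_norm_eq: "quad_norm A x = sqrt (q x)"
  by (simp add: quad_norm_def q_def)

lemma quad_norm_sq: "(quad_norm A x)\<^sup>2 = q x"
  by (simp add: quad_norm_eq q_nonneg)

lemma quad_norm_pos: "x \<noteq> 0 \<Longrightarrow> quad_norm A x > 0"
  by (simp add: quad_norm_eq q_pos)

lemma continuous_q: "continuous_on S q"
  unfolding q_def by (intro continuous_intros linear_continuous_on_compose matrix_vector_mul_linear)

lemma q_has_derivative: "(q has_derivative (\<lambda>v. 2 * ((A *v x) \<bullet> v))) (at x within S)"
proof -
  have "((\<lambda>x. A *v x) has_derivative (\<lambda>v. A *v v)) (at x within S)"
    by (intro linear_imp_has_derivative matrix_vector_mul_linear)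
  then show ?thesis
    unfolding q_def
    by (rule has_derivative_eq_rhs[OF has_derivative_inner])
      (auto simp: sym_inner[of x] inner_commute[of "A *v _" x] intro: has_derivative_ident)
qed

lemma GDERIV_quad_norm:
  assumes "x \<noteq> 0"
  shows "GDERIV (quad_norm A) x :> (A *v x) /\<^sub>R quad_norm A x"
proof -
  have "GDERIV q x :> 2 *\<^sub>R (A *v x)"
    unfolding gderiv_def using q_has_derivative[of x UNIV] by (simp add: inner_commute)
  moreover have "DERIV sqrt (q x) :> inverse (sqrt (q x)) / 2"
    using q_pos[OF assms] by (rule DERIV_real_sqrt)
  ultimately have "GDERIV (\<lambda>x. sqrt (q x)) x :> (inverse (sqrt (q x)) / 2) *\<^sub>R 2 *\<^sub>R (A *v x)"
    by (rule GDERIV_DERIV_compose)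
  then show ?thesis
    by (simp add: quad_norm_eq[abs_def])
qed

lemma grad_quad_norm: "x \<noteq> 0 \<Longrightarrow> grad (quad_norm A) x = (A *v x) /\<^sub>R quad_norm A x"
  by (intro grad_eq GDERIV_quad_norm)

lemma T_map_quad_norm: "T_map (quad_norm A) = T"
proof
  fix x
  show "T_map (quad_norm A) x = T x"
  proof (cases "x = 0")
    \<comment> \<open>\<open>grad\<close> is unspecified at the origin, but the factor
      \<open>inverse 0 = 0\<close> makes both maps vanish there.\<close>
    case True
    then show ?thesis
      by (simp add: T_map_def T_def quad_norm_def)
  next
    case False
    then show ?thesis
      by (simp add: T_map_def T_def grad_quad_norm quad_norm_sq[symmetric] power2_eq_square)
  qed
qed

text \<open>One factor of the norm cancels the denominator of its gradient; the resulting field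
  vanishes at the origin, in agreement with the convention there.\<close>

lemma finsler_flux_quad_norm:
  assumes "CARD('n) \<ge> 2"
  shows "finsler_flux (quad_norm A) \<eta> = quad_norm A \<eta> ^ (CARD('n) - 2) *\<^sub>R (A *v \<eta>)"
proof (cases "\<eta> = 0")
  case False
  have "CARD('n) - 1 = Suc (CARD('n) - 2)"
    using assms by simp
  then show ?thesis
    using False quad_norm_pos[OF False] by (simp add: finsler_flux_def grad_quad_norm)
qed (simp add: finsler_flux_def)

lemma T_has_derivative:
  assumes "x \<noteq> 0"
  shows "(T has_derivative DT x) (at x within S)"
proof -
  have "((\<lambda>x. A *v x) has_derivative (\<lambda>v. A *v v)) (at x within S)"
    by (intro linear_imp_has_derivative matrix_vector_mul_linear)
  moreover have "((\<lambda>x. inverse (q x)) has_derivative (\<lambda>v. - (inverse (q x) * (2 * ((A *v x) \<bullet> v)) * inverse (q x)))) (at x within S)"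
    using assms by (intro Deriv.has_derivative_inverse[OF _ q_has_derivative]) auto
  ultimately have "((\<lambda>x. inverse (q x) *\<^sub>R (A *v x)) has_derivative
     (\<lambda>v. inverse (q x) *\<^sub>R (A *v v) + (- (inverse (q x) * (2 * ((A *v x) \<bullet> v)) * inverse (q x))) *\<^sub>R (A *v x))) (at x within S)"
    by (intro has_derivative_scaleR)
  then show ?thesis
    unfolding T_def DT_def
    by (rule has_derivative_eq_rhs) (simp add: fun_eq_iff power2_eq_square inverse_eq_divide)
qed

text \<open>Off the origin \<open>T\<close> is the gradient of the logarithm of the norm, so
  \<open>DT\<close> is a Hessian; concretely, both \<open>A\<close> and the rank one term are
  symmetric.\<close>

lemma DT_sym: "DT x v \<bullet> w = v \<bullet> DT x w"
  using sym_inner[of v w] inner_commute[of v "A *v x"]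
  by (simp add: DT_def inner_diff_left inner_diff_right)

lemma continuous_T: "continuous_on (- {0}) T"
  using T_has_derivative by (intro has_derivative_continuous_on) auto

section \<open>The inverse matrix, the inverse of \<open>T\<close>, and conformality\<close>

lemma invertible: "invertible A"
  unfolding invertible_left_inverse matrix_left_invertible_ker
  by (metis inner_zero_left less_irrefl pos)

lemma matrix_inv: "A ** matrix_inv A = mat 1" "matrix_inv A ** A = mat 1"
  using someI_ex[OF invertible[unfolded invertible_def]] by (simp_all add: matrix_inv_def)

lemma inv_vec: "A *v (matrix_inv A *v x) = x" "matrix_inv A *v (A *v x) = x"
  by (simp_all add: matrix_vector_mul_assoc matrix_inv)

lemma inv_sym_inner: "(matrix_inv A *v x) \<bullet> y = x \<bullet> (matrix_inv A *v y)"
  by (metis inv_vec(1) sym_inner)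

lemma pos_def_matrix_inv: "pos_def_matrix (matrix_inv A)"
proof
  show "transpose (matrix_inv A) = matrix_inv A"
    unfolding matrix_eq
    by (metis inv_sym_inner dot_lmul_matrix transpose_matrix_vector vector_eq_ldot inner_commute)
  show "(matrix_inv A *v x) \<bullet> x > 0" if "x \<noteq> 0" for x
    using pos[of "matrix_inv A *v x"] that inv_vec(1)[of x] by (metis inner_commute matrix_vector_mult_0_right)
qed

text \<open>From here on \<open>inv.q\<close> and \<open>inv.T\<close> belong to the inverse matrix,
  that is, to the dual norm.\<close>

interpretation inv: pos_def_matrix "matrix_inv A"
  by (rule pos_def_matrix_inv)

lemma T_eq_0_iff [simp]: "T x = 0 \<longleftrightarrow> x = 0"
  by (metis T_def inv_vec(2) matrix_vector_mult_0_right q_eq_0_iff scaleR_eq_0_iff inverse_nonzero_iff_nonzero)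

lemma q_inv_mult: "q (matrix_inv A *v x) = inv.q x"
  by (simp add: q_def inv.q_def inv_vec inner_commute)

lemma inv_q_mult: "inv.q (A *v x) = q x"
  by (simp add: q_def inv.q_def inv_vec inner_commute)

lemma inv_q_T: "inv.q (T x) = 1 / q x"
  by (cases "x = 0") (simp_all add: T_def inv.q_scaleR inv_q_mult power2_eq_square divide_inverse)

lemma q_inv_T: "q (inv.T x) = 1 / inv.q x"
  by (cases "x = 0") (simp_all add: inv.T_def q_scaleR q_inv_mult power2_eq_square divide_inverse)

text \<open>\<open>matrix_inv A\<close> undoes \<open>A\<close>, and by \<open>inv_q_T\<close> the
  second normalisation multiplies by \<open>q x\<close>, which undoes the first. Both maps fix the
  origin.\<close>

lemma inv_T_T [simp]: "inv.T (T x) = x"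
  unfolding inv.T_def inv_q_T by (cases "x = 0") (simp_all add: T_def matrix_vector_mult_scaleR inv_vec)

lemma T_inv_T [simp]: "T (inv.T x) = x"
  unfolding T_def[of "inv.T x"] q_inv_T by (cases "x = 0") (simp_all add: inv.T_def matrix_vector_mult_scaleR inv_vec)

lemma inj_T: "inj_on T S"
  by (metis inj_onI inv_T_T)

lemma T_image: "T ` (- {0}) = - {0}"
proof -
  have "x \<in> T ` (- {0})" if "x \<noteq> 0" for x
    using that T_eq_0_iff[of "inv.T x"] by (intro image_eqI[of x T "inv.T x"]) auto
  then show ?thesis
    by auto
qed

text \<open>After expansion the two mixed terms, each with factor -2, cancel the quadratic term with
  factor 4, because \<open>A *v x\<close> paired with \<open>x\<close> gives
  \<open>q x\<close>.\<close>

lemma DT_conj: "(matrix_inv A *v DT x v) \<bullet> DT x w = ((A *v v) \<bullet> w) / (q x)\<^sup>2"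
proof (cases "x = 0")
  case False
  have eq: "matrix_inv A *v DT x v = v /\<^sub>R q x - (2 * ((A *v x) \<bullet> v) / (q x)\<^sup>2) *\<^sub>R x"
    by (simp add: DT_def matrix_vector_mult_diff_distrib matrix_vector_mult_scaleR inv_vec)
  have "x \<bullet> (A *v x) = q x"
    by (simp add: q_def inner_commute)
  moreover have "x \<bullet> (A *v w) = (A *v x) \<bullet> w" "v \<bullet> (A *v w) = (A *v v) \<bullet> w"
    by (simp_all add: sym_inner)
  moreover have "v \<bullet> (A *v x) = (A *v x) \<bullet> v"
    by (rule inner_commute)
  ultimately show ?thesis
    using False unfolding eq
    by (simp add: DT_def[of x w] inner_diff_left inner_diff_right field_simps power2_eq_square)
qed (simp add: DT_def)

text \<open>With \<open>DT_sym\<close>, the relation \<open>DT_conj\<close> becomes a matrix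
  identity: \<open>D\<close>, the inverse of \<open>A\<close> and \<open>D\<close> multiply to
  \<open>A\<close> divided by the square of \<open>q x\<close>. Determinants then give the square of
  the claim, whose two sides are nonnegative.\<close>

lemma det_DT:
  assumes "x \<noteq> 0"
  shows "\<bar>det (matrix (DT x))\<bar> = \<bar>det A\<bar> / q x ^ CARD('n)"
proof -
  define D where "D = matrix (DT x)"
  have "linear (DT x)"
    using T_has_derivative[OF assms] has_derivative_linear by blast
  then have D: "D *v v = DT x v" for v
    by (simp add: D_def matrix_works)
  have "DT x (matrix_inv A *v DT x v) = (1 / (q x)\<^sup>2) *\<^sub>R (A *v v)" for v
    by (rule vector_eq_rdot[THEN iffD1]) (simp add: DT_sym DT_conj)
  then have "D ** matrix_inv A ** D = matrix ((*\<^sub>R) (1 / (q x)\<^sup>2)) ** A"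
    unfolding matrix_eq by (simp add: D matrix_vector_mul_assoc[symmetric] matrix_works del: det_matrix_scaleR)
  then have "det D * det (matrix_inv A) * det D = (1 / (q x)\<^sup>2) ^ CARD('n) * det A"
    by (metis det_matrix_scaleR det_mul)
  moreover have "det A * det (matrix_inv A) = 1"
    by (metis det_I det_mul matrix_inv(1))
  ultimately have "(det D)\<^sup>2 = det A * ((1 / (q x)\<^sup>2) ^ CARD('n) * det A)"
    by (metis (no_types, opaque_lifting) mult.assoc mult.commute mult.right_neutral power2_eq_square)
  also have "\<dots> = (\<bar>det A\<bar> / q x ^ CARD('n))\<^sup>2"
    by (simp add: power2_eq_square power_divide power_mult_distrib)
  finally have "(det D)\<^sup>2 = (\<bar>det A\<bar> / q x ^ CARD('n))\<^sup>2" .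
  moreover have "0 \<le> \<bar>det A\<bar> / q x ^ CARD('n)"
    using q_nonneg by simp
  ultimately show ?thesis
    unfolding D_def[symmetric] by (metis abs_ge_zero power2_abs power2_eq_iff_nonneg)
qed

lemma dual_norm_quad_norm: "dual_norm (quad_norm A) = quad_norm (matrix_inv A)"
proof
  fix x
  show "dual_norm (quad_norm A) x = quad_norm (matrix_inv A) x"
    unfolding dual_norm_def
  proof (rule cSup_eq_maximum)
    define r where "r = quad_norm (matrix_inv A) x"
    have r: "r\<^sup>2 = inv.q x" "r \<ge> 0"
      by (simp_all add: r_def inv.quad_norm_sq inv.quad_norm_eq inv.q_nonneg)
    show "quad_norm (matrix_inv A) x \<in> {\<xi> \<bullet> x |\<xi>. quad_norm A \<xi> \<le> 1}"
    proof (cases "x = 0")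
      case True
      then show ?thesis
        by (auto simp: quad_norm_def intro!: exI[of _ 0])
    next
      case False
      then have "r > 0"
        unfolding r_def by (rule inv.quad_norm_pos)
      \<comment> \<open>The maximiser is \<open>matrix_inv A *v x\<close> normalised by
        \<open>r\<close>: it has norm 1 and pairs with \<open>x\<close> to \<open>r\<close>.\<close>
      have "q (matrix_inv A *v x /\<^sub>R r) = r\<^sup>2 / r\<^sup>2" "(matrix_inv A *v x /\<^sub>R r) \<bullet> x = r\<^sup>2 / r"
        by (simp_all add: r q_scaleR q_inv_mult inv.q_def power_inverse divide_inverse)
      then have "quad_norm A (matrix_inv A *v x /\<^sub>R r) = 1" "(matrix_inv A *v x /\<^sub>R r) \<bullet> x = r"
        using \<open>r > 0\<close> by (simp_all add: quad_norm_eq power2_eq_square)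
      then show ?thesis
        unfolding r_def[symmetric] by (intro CollectI exI[of _ "matrix_inv A *v x /\<^sub>R r"]) auto
    qed
    fix s
    assume "s \<in> {\<xi> \<bullet> x |\<xi>. quad_norm A \<xi> \<le> 1}"
    then obtain \<xi> where \<xi>: "s = \<xi> \<bullet> x" "quad_norm A \<xi> \<le> 1"
      by auto
    have "q \<xi> \<le> 1"
      using \<xi>(2) by (simp add: quad_norm_eq)
    \<comment> \<open>This is the proof of the Cauchy-Schwarz inequality for \<open>q\<close>:
      expand the form at the difference of \<open>r\<close> times the competitor and the
      unnormalised maximiser.\<close>
    have "0 \<le> q (r *\<^sub>R \<xi> - matrix_inv A *v x)"
      by (rule q_nonneg)
    also have "\<dots> = r\<^sup>2 * q \<xi> - 2 * r * s + r\<^sup>2"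
      by (simp add: q_diff q_scaleR q_inv_mult r(1) \<xi>(1) matrix_vector_mult_scaleR sym_inner inv_vec)
    also have "\<dots> \<le> r\<^sup>2 * 1 - 2 * r * s + r\<^sup>2"
      using \<open>q \<xi> \<le> 1\<close> by (intro add_right_mono diff_right_mono mult_left_mono) auto
    finally have le: "r * s \<le> r * r"
      by (simp add: power2_eq_square)
    \<comment> \<open>For \<open>r = 0\<close> the inequality \<open>le\<close> says nothing about
      \<open>s\<close>; this case is settled through \<open>x = 0\<close>.\<close>
    have "s \<le> 0" if "r = 0"
    proof -
      have "x = 0"
        using that r(1) by simp
      then show ?thesis
        by (simp add: \<xi>(1))
    qed
    then show "s \<le> quad_norm (matrix_inv A) x"
      using le r(2) unfolding r_def[symmetric] by (cases "r = 0") auto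
  qed
qed

end

section \<open>Test functions and local integrability\<close>

lemma GDERIV_grad:
  assumes "\<phi> \<in> C1_compact_support \<Omega>"
  shows "GDERIV \<phi> x :> grad \<phi> x"
proof -
  obtain \<phi>' where \<phi>': "(\<phi> has_derivative \<phi>') (at x)"
    using assms by (auto simp: C1_compact_support_def differentiable_def)
  \<comment> \<open>Riesz representation: the adjoint of a functional, evaluated at 1, represents
    it.\<close>
  then have "h \<bullet> adjoint \<phi>' 1 = \<phi>' h" for h
    by (simp add: adjoint_works has_derivative_linear)
  then have "GDERIV \<phi> x :> adjoint \<phi>' 1"
    using \<phi>' by (simp add: gderiv_def)
  then show ?thesis
    by (simp add: grad_eq)
qed

lemma GDERIV_eq_0:
  assumes "open U" "x \<in> U" "\<And>y. y \<in> U \<Longrightarrow> f y = 0"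
  shows "GDERIV f x :> 0"
proof -
  have "((\<lambda>_. 0) has_derivative (\<lambda>h. h \<bullet> 0)) (at x)"
    by simp
  then show ?thesis
    unfolding gderiv_def using assms(1,2)
    by (rule has_derivative_transform_within_open) (simp add: assms(3))
qed

lemma C1_compact_support_subset: "C1_compact_support \<Omega> \<subseteq> C1_compact_support \<Omega>'" if "\<Omega> \<subseteq> \<Omega>'"
  using that by (auto simp: C1_compact_support_def)

text \<open>Off \<open>K\<close> the function is locally zero, so its gradient is continuous there;
  the two open sets \<open>\<Omega>\<close> and \<open>- K\<close> cover the space.\<close>

lemma C1_compact_supportI:
  assumes "open \<Omega>" "compact K" "K \<subseteq> \<Omega>"
    and zero: "\<And>x. x \<notin> K \<Longrightarrow> f x = 0"
    and der: "\<And>x. x \<in> \<Omega> \<Longrightarrow> GDERIV f x :> F x"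
    and cont: "continuous_on \<Omega> F"
  shows "f \<in> C1_compact_support \<Omega>"
proof -
  have opn: "open (- K)"
    using \<open>compact K\<close> by (simp add: compact_imp_closed open_Compl)
  have der0: "GDERIV f x :> 0" if "x \<notin> K" for x
    using that zero by (intro GDERIV_eq_0[OF opn]) auto
  have "f differentiable (at x)" for x
    using der[of x] der0[of x] \<open>K \<subseteq> \<Omega>\<close> unfolding gderiv_def differentiable_def by blast
  moreover have "continuous_on UNIV (grad f)"
  proof -
    have "continuous_on \<Omega> (grad f)"
      using cont by (rule continuous_on_eq) (simp add: grad_eq[OF der])
    moreover have "continuous_on (- K) (grad f)"
      by (rule continuous_on_eq[of _ "\<lambda>_. 0"]) (simp_all add: grad_eq[OF der0])
    ultimately have "continuous_on (\<Omega> \<union> - K) (grad f)"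
      using \<open>open \<Omega>\<close> opn by (simp add: continuous_on_open_Un)
    moreover have "\<Omega> \<union> - K = UNIV"
      using \<open>K \<subseteq> \<Omega>\<close> by auto
    ultimately show ?thesis
      by simp
  qed
  moreover have "closure {x. f x \<noteq> 0} \<subseteq> K"
    using zero \<open>compact K\<close> by (intro closure_minimal compact_imp_closed) auto
  moreover from this have "compact (closure {x. f x \<noteq> 0})"
    using \<open>compact K\<close> bounded_subset compact_eq_bounded_closed by blast
  ultimately show ?thesis
    using \<open>K \<subseteq> \<Omega>\<close> by (auto simp: C1_compact_support_def)
qed

text \<open>A continuous weight is bounded on each compact subset, so the power of \<open>h\<close>
  is dominated there by a constant multiple of that of \<open>f\<close>.\<close>

lemma Lp_loc_bound:
  assumes f: "f \<in> Lp_loc p \<Omega>" and "p \<ge> 0" "\<Omega> \<in> sets lebesgue"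
    and h: "h \<in> borel_measurable (lebesgue_on \<Omega>)"
    and w: "continuous_on \<Omega> w"
    and le: "\<And>x. x \<in> \<Omega> \<Longrightarrow> norm (h x) \<le> w x * norm (f x)"
  shows "h \<in> Lp_loc p \<Omega>"
  unfolding Lp_loc_def
proof (intro CollectI conjI h allI impI)
  fix C assume C: "compact C \<and> C \<subseteq> \<Omega>"
  then have "bounded (w ` C)"
    using w by (meson compact_continuous_image compact_imp_bounded continuous_on_subset)
  then obtain b where b: "b > 0" "\<And>x. x \<in> C \<Longrightarrow> norm (w x) \<le> b"
    unfolding bounded_pos by auto
  have Cs: "C \<in> sets lebesgue"
    using C by (simp add: borel_compact)
  have "integrable (lebesgue_on C) (\<lambda>x. norm (f x) powr p)"
    using f C Cs by (simp add: Lp_loc_def integrable_restrict_space set_integrable_def)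
  then have int: "integrable (lebesgue_on C) (\<lambda>x. b powr p * norm (f x) powr p)"
    by simp
  have "h \<in> borel_measurable (lebesgue_on C)"
    using h C by (meson measurable_restrict_mono)
  then have meas: "(\<lambda>x. norm (h x) powr p) \<in> borel_measurable (lebesgue_on C)"
    by simp
  have "norm (norm (h x) powr p) \<le> norm (b powr p * norm (f x) powr p)" if "x \<in> C" for x
  proof -
    have "w x \<le> b"
      using b(2)[OF that] by simp
    then have "norm (h x) \<le> b * norm (f x)"
      using le[of x] that C mult_right_mono[of "w x" b "norm (f x)"] by force
    then have "norm (h x) powr p \<le> (b * norm (f x)) powr p"
      using \<open>p \<ge> 0\<close> by (intro powr_mono2) auto
    then show ?thesis
      using b(1) by (simp add: powr_mult)
  qed
  then have "integrable (lebesgue_on C) (\<lambda>x. norm (h x) powr p)"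
    using Cs by (intro Bochner_Integration.integrable_bound[OF int meas] AE_I2) simp
  then show "set_integrable lebesgue C (\<lambda>x. norm (h x) powr p)"
    using Cs by (simp add: integrable_restrict_space set_integrable_def)
qed

text \<open>Turns local into global integrability: only the compact set \<open>K\<close>
  contributes.\<close>

lemma set_integrable_Lp_loc_1:
  assumes f: "f \<in> Lp_loc 1 \<Omega>" and K: "compact K" "K \<subseteq> \<Omega>"
    and zero: "\<And>x. x \<in> \<Omega> - K \<Longrightarrow> f x = 0"
  shows "set_integrable lebesgue \<Omega> f"
proof -
  have Ks: "K \<in> sets lebesgue"
    using K by (simp add: borel_compact)
  have "f \<in> borel_measurable (lebesgue_on K)"
    using f K by (auto simp: Lp_loc_def intro: measurable_restrict_mono)
  moreover have "integrable (lebesgue_on K) (\<lambda>x. norm (f x))"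
    using f K Ks by (simp add: Lp_loc_def integrable_restrict_space set_integrable_def)
  ultimately have "integrable (lebesgue_on K) f"
    using integrable_norm_iff by blast
  then have "set_integrable lebesgue K f"
    using Ks by (simp add: integrable_restrict_space set_integrable_def)
  moreover have "indicator K x *\<^sub>R f x = indicator \<Omega> x *\<^sub>R f x" for x
    using K zero[of x] by (auto simp: indicator_def)
  ultimately show ?thesis
    by (simp add: set_integrable_def)
qed

section \<open>Integrals and local integrability under \<open>T\<close>\<close>

context pos_def_matrix
begin

interpretation inv: pos_def_matrix "matrix_inv A"
  by (rule pos_def_matrix_inv)

lemma det_nz: "det A \<noteq> 0"
  using matrix_inv by (metis det_I det_mul mult_zero_left zero_neq_one)

text \<open>By \<open>det_DT\<close>, the weight is the Jacobian of \<open>T\<close> divided by the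
  constant absolute value of \<open>det A\<close>.\<close>

lemma
  assumes S: "S \<in> sets lebesgue" "0 \<notin> S"
  shows set_integrable_T: "set_integrable lebesgue S (\<lambda>x. f (T x) / q x ^ CARD('n)) \<longleftrightarrow> set_integrable lebesgue (T ` S) f"
    and set_integral_T: "(LINT x:S|lebesgue. f (T x) / q x ^ CARD('n)) = (LINT x:T ` S|lebesgue. f x) / \<bar>det A\<bar>"
proof -
  have der: "(T has_derivative DT x) (at x within S)" if "x \<in> S" for x
    using that S by (intro T_has_derivative) auto
  have eq: "f (T x) / q x ^ CARD('n) = \<bar>det (matrix (DT x))\<bar> * f (T x) / \<bar>det A\<bar>" if "x \<in> S" for x
    using that S det_nz by (subst det_DT) auto
  have "set_integrable lebesgue S (\<lambda>x. f (T x) / q x ^ CARD('n))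
      \<longleftrightarrow> set_integrable lebesgue S (\<lambda>x. \<bar>det (matrix (DT x))\<bar> * f (T x) / \<bar>det A\<bar>)"
    by (intro set_integrable_cong eq refl)
  also have "\<dots> \<longleftrightarrow> set_integrable lebesgue S (\<lambda>x. \<bar>det (matrix (DT x))\<bar> * f (T x))"
    using det_nz by simp
  also have "\<dots> \<longleftrightarrow> set_integrable lebesgue (T ` S) f"
    by (intro set_integrable_change_of_variables S der inj_T)
  finally show "set_integrable lebesgue S (\<lambda>x. f (T x) / q x ^ CARD('n)) \<longleftrightarrow> set_integrable lebesgue (T ` S) f" .
  have "(LINT x:S|lebesgue. f (T x) / q x ^ CARD('n))
      = (LINT x:S|lebesgue. \<bar>det (matrix (DT x))\<bar> * f (T x) / \<bar>det A\<bar>)"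
    using S eq by (intro set_lebesgue_integral_cong) auto
  also have "\<dots> = (LINT x:S|lebesgue. \<bar>det (matrix (DT x))\<bar> * f (T x)) / \<bar>det A\<bar>"
    by simp
  also have "(LINT x:S|lebesgue. \<bar>det (matrix (DT x))\<bar> * f (T x)) = (LINT x:T ` S|lebesgue. f x)"
    by (intro lebesgue_integral_change_of_variables S der inj_T)
  finally show "(LINT x:S|lebesgue. f (T x) / q x ^ CARD('n)) = (LINT x:T ` S|lebesgue. f x) / \<bar>det A\<bar>" .
qed

text \<open>A preimage under \<open>T\<close> is an image under \<open>inv.T\<close>, which is
  differentiable off the origin and hence preserves Lebesgue measurability; continuity alone would
  only reach Borel sets.\<close>

lemma measurable_T: "T \<in> lebesgue_on (- {0}) \<rightarrow>\<^sub>M lebesgue"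
proof (rule measurableI)
  fix X :: "(real ^ 'n) set"
  assume X: "X \<in> sets lebesgue"
  have "inv.T differentiable_on (X - {0})"
    using inv.T_has_derivative by (auto simp: differentiable_on_def differentiable_def)
  moreover have "X - {0} \<in> sets lebesgue"
    using X by auto
  moreover have "T -` X \<inter> (- {0}) = inv.T ` (X - {0})"
    by (auto simp: image_iff) (metis DiffI T_eq_0_iff inv_T_T singletonD)
  ultimately have "T -` X \<inter> (- {0}) \<in> sets lebesgue"
    by (simp add: differentiable_image_in_sets_lebesgue)
  then show "T -` X \<inter> space (lebesgue_on (- {0})) \<in> sets (lebesgue_on (- {0}))"
    by (simp add: sets_restrict_space_iff)
qed simp

text \<open>\<open>T\<close> maps a compact set off the origin to a compact set, where
  \<open>f\<close> is under control. The change of variables brings in the weight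
  \<open>1 / q x ^ CARD('n)\<close>, which is removed because \<open>q\<close> is bounded on the
  compact set.\<close>

lemma Lp_loc_T:
  assumes f: "f \<in> Lp_loc p UNIV" and "p \<ge> 0"
  shows "(\<lambda>x. f (T x)) \<in> Lp_loc p (- {0})"
  unfolding Lp_loc_def
proof (intro CollectI conjI allI impI)
  have "f \<in> borel_measurable lebesgue"
    using f by (simp add: Lp_loc_def lebesgue_on_UNIV_eq)
  then show meas: "(\<lambda>x. f (T x)) \<in> borel_measurable (lebesgue_on (- {0}))"
    by (rule measurable_compose[OF measurable_T])
  fix C assume C: "compact C \<and> C \<subseteq> - {0 :: real ^ 'n}"
  then have Cs: "C \<in> sets lebesgue" "0 \<notin> C"
    by (auto simp: borel_compact)
  have "compact (T ` C)"
    using C continuous_T by (meson compact_continuous_image continuous_on_subset)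
  then have "set_integrable lebesgue (T ` C) (\<lambda>x. norm (f x) powr p)"
    using f by (simp add: Lp_loc_def)
  then have int: "integrable (lebesgue_on C) (\<lambda>x. norm (f (T x)) powr p / q x ^ CARD('n))"
    using set_integrable_T[OF Cs, of "\<lambda>x. norm (f x) powr p"] Cs
    by (simp add: integrable_restrict_space set_integrable_def)
  obtain b where b: "b > 0" "\<And>x. x \<in> C \<Longrightarrow> norm (q x ^ CARD('n)) \<le> b"
  proof -
    have "bounded ((\<lambda>x. q x ^ CARD('n)) ` C)"
      using C by (intro compact_imp_bounded compact_continuous_image continuous_intros continuous_q) auto
    then show ?thesis
      using that unfolding bounded_pos by auto
  qed
  have meas: "(\<lambda>x. norm (f (T x)) powr p) \<in> borel_measurable (lebesgue_on C)"
  proof -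
    have "(\<lambda>x. f (T x)) \<in> borel_measurable (lebesgue_on C)"
      using meas C by (meson measurable_restrict_mono)
    then show ?thesis
      by simp
  qed
  have "norm (norm (f (T x)) powr p) \<le> norm (b * (norm (f (T x)) powr p / q x ^ CARD('n)))" if "x \<in> C" for x
  proof -
    have "q x ^ CARD('n) > 0"
      using that Cs by (metis q_pos zero_less_power)
    then have "norm (f (T x)) powr p = q x ^ CARD('n) * (norm (f (T x)) powr p / q x ^ CARD('n))"
      by (metis nonzero_mult_div_cancel_left order_less_irrefl times_divide_eq_right)
    also have "\<dots> \<le> b * (norm (f (T x)) powr p / q x ^ CARD('n))"
      using b(2)[OF that] \<open>q x ^ CARD('n) > 0\<close> by (intro mult_right_mono) auto
    also have "\<dots> \<le> \<bar>b * (norm (f (T x)) powr p / q x ^ CARD('n))\<bar>"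
      by (rule abs_ge_self)
    finally show ?thesis
      by (simp only: real_norm_def abs_of_nonneg[OF powr_ge_zero])
  qed
  then have "integrable (lebesgue_on C) (\<lambda>x. norm (f (T x)) powr p)"
    using Cs by (intro Bochner_Integration.integrable_bound[OF integrable_mult_right[OF int, of b] meas] AE_I2) simp
  then show "set_integrable lebesgue C (\<lambda>x. norm (f (T x)) powr p)"
    using Cs by (simp add: integrable_restrict_space set_integrable_def)
qed

end

section \<open>Transport of the weak gradient and of weak solutions\<close>

lemma C1_compact_supportE:
  assumes "\<phi> \<in> C1_compact_support \<Omega>"
  obtains K where "compact K" "K \<subseteq> \<Omega>" "\<And>x. x \<notin> K \<Longrightarrow> \<phi> x = 0" "\<And>x. x \<notin> K \<Longrightarrow> grad \<phi> x = 0"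
proof
  let ?K = "closure {x. \<phi> x \<noteq> 0}"
  show "compact ?K" "?K \<subseteq> \<Omega>"
    using assms by (auto simp: C1_compact_support_def)
  show zero: "\<phi> x = 0" if "x \<notin> ?K" for x
    using that closure_subset[of "{x. \<phi> x \<noteq> 0}"] by auto
  show "grad \<phi> x = 0" if "x \<notin> ?K" for x
    by (rule grad_eq, rule GDERIV_eq_0[of "- ?K"]) (use that zero in \<open>simp_all only: open_Compl closed_closure Compl_iff not_False_eq_True\<close>)
qed

lemma GDERIV_imp_continuous_on: "continuous_on S f" if "\<And>x. x \<in> S \<Longrightarrow> GDERIV f x :> F x"
  by (intro continuous_at_imp_continuous_on ballI, rule has_derivative_continuous)
    (rule that[unfolded gderiv_def])

lemma C1_continuous: "continuous_on S \<phi>" if "\<phi> \<in> C1_compact_support \<Omega>"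
  by (rule GDERIV_imp_continuous_on) (rule GDERIV_grad[OF that])

lemma C1_continuous_grad: "continuous_on S (grad \<phi>)" if "\<phi> \<in> C1_compact_support \<Omega>"
  by (rule continuous_on_subset[of UNIV]) (use that in \<open>auto simp: C1_compact_support_def\<close>)

lemma set_integral_zero_outside:
  assumes "\<Omega> \<subseteq> \<Omega>'" "\<And>x. x \<in> \<Omega>' - \<Omega> \<Longrightarrow> f x = 0"
  shows "(LINT x:\<Omega>'|M. f x) = (LINT x:\<Omega>|M. f x)"
  unfolding set_lebesgue_integral_def using assms
  by (intro Bochner_Integration.integral_cong refl) (auto simp: indicator_def)

lemma Lp_loc_subset:
  assumes "f \<in> Lp_loc p \<Omega>'" "\<Omega> \<subseteq> \<Omega>'"
  shows "f \<in> Lp_loc p \<Omega>"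
  using assms by (auto simp: Lp_loc_def intro: measurable_restrict_mono)

lemma has_weak_gradient_subset:
  assumes "has_weak_gradient \<Omega>' u G" "\<Omega> \<subseteq> \<Omega>'"
  shows "has_weak_gradient \<Omega> u G"
  unfolding has_weak_gradient_def
proof (intro conjI ballI)
  fix \<phi> :: "'a \<Rightarrow> real" assume \<phi>: "\<phi> \<in> C1_compact_support \<Omega>"
  then obtain K where "K \<subseteq> \<Omega>" "\<And>x. x \<notin> K \<Longrightarrow> \<phi> x = 0" "\<And>x. x \<notin> K \<Longrightarrow> grad \<phi> x = 0"
    by (rule C1_compact_supportE) blast
  then have "\<phi> x = 0" "grad \<phi> x = 0" if "x \<notin> \<Omega>" for x
    using that by blast+
  then have "(LINT x:\<Omega>'|lebesgue. u x *\<^sub>R grad \<phi> x) = (LINT x:\<Omega>|lebesgue. u x *\<^sub>R grad \<phi> x)"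
    "(LINT x:\<Omega>'|lebesgue. \<phi> x *\<^sub>R G x) = (LINT x:\<Omega>|lebesgue. \<phi> x *\<^sub>R G x)"
    using assms(2) by (auto intro!: set_integral_zero_outside)
  moreover have "\<phi> \<in> C1_compact_support \<Omega>'"
    using \<phi> assms(2) C1_compact_support_subset by blast
  ultimately show "(LINT x:\<Omega>|lebesgue. u x *\<^sub>R grad \<phi> x) = - (LINT x:\<Omega>|lebesgue. \<phi> x *\<^sub>R G x)"
    using assms(1) by (simp add: has_weak_gradient_def)
qed (use assms Lp_loc_subset in \<open>auto simp: has_weak_gradient_def\<close>)

text \<open>One factor is locally integrable, the other continuous and zero off \<open>K\<close>;
  the two versions differ in whether the scalar or the vector factor is the rough one.\<close>

lemma
  fixes f :: "'a::euclidean_space \<Rightarrow> real" and F :: "'a \<Rightarrow> 'b::euclidean_space"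
  assumes "open \<Omega>" and K: "compact K" "K \<subseteq> \<Omega>"
  shows set_integrable_scaleR_continuous:
      "f \<in> Lp_loc 1 \<Omega> \<Longrightarrow> continuous_on \<Omega> F \<Longrightarrow> (\<And>x. x \<in> \<Omega> - K \<Longrightarrow> F x = 0) \<Longrightarrow>
        set_integrable lebesgue \<Omega> (\<lambda>x. f x *\<^sub>R F x)"
    and set_integrable_continuous_scaleR:
      "F \<in> Lp_loc 1 \<Omega> \<Longrightarrow> continuous_on \<Omega> f \<Longrightarrow> (\<And>x. x \<in> \<Omega> - K \<Longrightarrow> f x = 0) \<Longrightarrow>
        set_integrable lebesgue \<Omega> (\<lambda>x. f x *\<^sub>R F x)"
proof -
  have \<Omega>: "\<Omega> \<in> sets lebesgue"
    using \<open>open \<Omega>\<close> by auto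
  show "set_integrable lebesgue \<Omega> (\<lambda>x. f x *\<^sub>R F x)"
    if f: "f \<in> Lp_loc 1 \<Omega>" and F: "continuous_on \<Omega> F" and zero: "\<And>x. x \<in> \<Omega> - K \<Longrightarrow> F x = 0"
  proof (rule set_integrable_Lp_loc_1[OF _ K])
    have "(\<lambda>x. f x *\<^sub>R F x) \<in> borel_measurable (lebesgue_on \<Omega>)"
      using f continuous_imp_measurable_on_sets_lebesgue[OF F \<Omega>]
      by (intro borel_measurable_scaleR) (auto simp: Lp_loc_def)
    then show "(\<lambda>x. f x *\<^sub>R F x) \<in> Lp_loc 1 \<Omega>"
      using f F \<Omega> by (intro Lp_loc_bound[OF f, where w = "\<lambda>x. norm (F x)"] continuous_intros) auto
  qed (simp add: zero)
  show "set_integrable lebesgue \<Omega> (\<lambda>x. f x *\<^sub>R F x)"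
    if F: "F \<in> Lp_loc 1 \<Omega>" and f: "continuous_on \<Omega> f" and zero: "\<And>x. x \<in> \<Omega> - K \<Longrightarrow> f x = 0"
  proof (rule set_integrable_Lp_loc_1[OF _ K])
    have "(\<lambda>x. f x *\<^sub>R F x) \<in> borel_measurable (lebesgue_on \<Omega>)"
      using F continuous_imp_measurable_on_sets_lebesgue[OF f \<Omega>]
      by (intro borel_measurable_scaleR) (auto simp: Lp_loc_def)
    then show "(\<lambda>x. f x *\<^sub>R F x) \<in> Lp_loc 1 \<Omega>"
      using f F \<Omega> by (intro Lp_loc_bound[OF F, where w = "\<lambda>x. norm (f x)"] continuous_intros) auto
  qed (simp add: zero)
qed

lemma set_integral_inner:
  fixes f :: "'a \<Rightarrow> 'b::euclidean_space"
  assumes "set_integrable M S f"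
  shows "set_integrable M S (\<lambda>x. f x \<bullet> c)" "(LINT x:S|M. f x \<bullet> c) = (LINT x:S|M. f x) \<bullet> c"
  using integrable_inner_left[of c, OF assms[unfolded set_integrable_def]]
    integral_inner_left[of c, OF assms[unfolded set_integrable_def]]
  by (simp_all add: set_integrable_def set_lebesgue_integral_def)

text \<open>Each component of \<open>V\<close> times \<open>\<psi>\<close> is a test function.
  Testing the matching component of the weak gradient and summing produces the divergence of this
  product field, in which the part with the divergence of \<open>V\<close> drops out.\<close>

lemma weak_gradient_divergence_free:
  fixes V :: "'a::euclidean_space \<Rightarrow> 'a"
  assumes "open \<Omega>" and wg: "has_weak_gradient \<Omega> u G"
    and \<psi>: "\<psi> \<in> C1_compact_support \<Omega>"
    and der: "\<And>b x. b \<in> Basis \<Longrightarrow> x \<in> \<Omega> \<Longrightarrow> GDERIV (\<lambda>x. V x \<bullet> b) x :> V' b x"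
    and cont: "\<And>b. b \<in> Basis \<Longrightarrow> continuous_on \<Omega> (V' b)"
    and div: "\<And>x. x \<in> \<Omega> \<Longrightarrow> (\<Sum>b\<in>Basis. V' b x \<bullet> b) = 0"
  shows "(LINT x:\<Omega>|lebesgue. u x * (grad \<psi> x \<bullet> V x)) = - (LINT x:\<Omega>|lebesgue. \<psi> x * (G x \<bullet> V x))"
proof -
  obtain K where K: "compact K" "K \<subseteq> \<Omega>"
    and zero: "\<And>x. x \<notin> K \<Longrightarrow> \<psi> x = 0" "\<And>x. x \<notin> K \<Longrightarrow> grad \<psi> x = 0"
    by (rule C1_compact_supportE[OF \<psi>]) (rule that)
  define F where "F b x = \<psi> x *\<^sub>R V' b x + (V x \<bullet> b) *\<^sub>R grad \<psi> x" for b x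
  have Vb: "continuous_on \<Omega> (\<lambda>x. V x \<bullet> b)" if "b \<in> Basis" for b
    by (rule GDERIV_imp_continuous_on) (rule der[OF that])
  have F_cont: "continuous_on \<Omega> (F b)" if "b \<in> Basis" for b
    unfolding F_def
    by (intro continuous_intros cont that Vb C1_continuous[OF \<psi>] C1_continuous_grad[OF \<psi>])
  have F_der: "GDERIV (\<lambda>x. \<psi> x * (V x \<bullet> b)) x :> F b x" if "b \<in> Basis" "x \<in> \<Omega>" for b x
    unfolding F_def by (intro GDERIV_mult GDERIV_grad[OF \<psi>] der that)
  have int1: "set_integrable lebesgue \<Omega> (\<lambda>x. u x *\<^sub>R F b x)" if "b \<in> Basis" for b
    using wg zero by (intro set_integrable_scaleR_continuous[OF \<open>open \<Omega>\<close> K] F_cont that)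
      (auto simp: has_weak_gradient_def F_def)
  have int2: "set_integrable lebesgue \<Omega> (\<lambda>x. (\<psi> x * (V x \<bullet> b)) *\<^sub>R G x)" if "b \<in> Basis" for b
    using wg zero
    by (intro set_integrable_continuous_scaleR[OF \<open>open \<Omega>\<close> K] continuous_intros Vb that C1_continuous[OF \<psi>])
      (auto simp: has_weak_gradient_def)
  have eq: "(LINT x:\<Omega>|lebesgue. (u x *\<^sub>R F b x) \<bullet> b) = - (LINT x:\<Omega>|lebesgue. ((\<psi> x * (V x \<bullet> b)) *\<^sub>R G x) \<bullet> b)"
    if b: "b \<in> Basis" for b
  proof -
    let ?\<phi> = "\<lambda>x. \<psi> x * (V x \<bullet> b)"
    have "?\<phi> \<in> C1_compact_support \<Omega>"
      using zero by (intro C1_compact_supportI[OF \<open>open \<Omega>\<close> K _ F_der F_cont] b) auto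
    then have "(LINT x:\<Omega>|lebesgue. u x *\<^sub>R grad ?\<phi> x) = - (LINT x:\<Omega>|lebesgue. ?\<phi> x *\<^sub>R G x)"
      using wg by (simp add: has_weak_gradient_def)
    moreover have "(LINT x:\<Omega>|lebesgue. u x *\<^sub>R grad ?\<phi> x) = (LINT x:\<Omega>|lebesgue. u x *\<^sub>R F b x)"
      using \<open>open \<Omega>\<close> b by (intro set_lebesgue_integral_cong) (auto simp: grad_eq[OF F_der])
    ultimately show ?thesis
      using set_integral_inner(2)[OF int1[OF b], of b] set_integral_inner(2)[OF int2[OF b], of b]
      by simp
  qed
  \<comment> \<open>The parts of \<open>F\<close> that carry the factor \<open>\<psi>\<close> add up
    to a multiple of the divergence of \<open>V\<close>, so only those with
    \<open>grad \<psi>\<close> survive.\<close>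
  have "(LINT x:\<Omega>|lebesgue. u x * (grad \<psi> x \<bullet> V x)) = (LINT x:\<Omega>|lebesgue. (\<Sum>b\<in>Basis. (u x *\<^sub>R F b x) \<bullet> b))"
  proof (intro set_lebesgue_integral_cong allI impI)
    fix x assume "x \<in> \<Omega>"
    then show "u x * (grad \<psi> x \<bullet> V x) = (\<Sum>b\<in>Basis. (u x *\<^sub>R F b x) \<bullet> b)"
      using div[of x]
      by (simp add: F_def inner_add_left sum.distrib euclidean_inner[of "grad \<psi> x" "V x"] mult.commute
          flip: sum_distrib_left)
  qed (use \<open>open \<Omega>\<close> in auto)
  also have "\<dots> = (\<Sum>b\<in>Basis. LINT x:\<Omega>|lebesgue. (u x *\<^sub>R F b x) \<bullet> b)"
    using set_integral_inner(1)[OF int1]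
    unfolding set_lebesgue_integral_def set_integrable_def scaleR_sum_right
    by (intro Bochner_Integration.integral_sum) auto
  also have "\<dots> = - (\<Sum>b\<in>Basis. LINT x:\<Omega>|lebesgue. ((\<psi> x * (V x \<bullet> b)) *\<^sub>R G x) \<bullet> b)"
    by (simp only: eq sum_negf cong: sum.cong)
  also have "(\<Sum>b\<in>Basis. LINT x:\<Omega>|lebesgue. ((\<psi> x * (V x \<bullet> b)) *\<^sub>R G x) \<bullet> b)
      = (LINT x:\<Omega>|lebesgue. (\<Sum>b\<in>Basis. ((\<psi> x * (V x \<bullet> b)) *\<^sub>R G x) \<bullet> b))"
    using set_integral_inner(1)[OF int2]
    unfolding set_lebesgue_integral_def set_integrable_def scaleR_sum_right
    by (intro Bochner_Integration.integral_sum[symmetric]) auto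
  also have "\<dots> = (LINT x:\<Omega>|lebesgue. \<psi> x * (G x \<bullet> V x))"
    by (simp add: euclidean_inner[of "G _" "V _"] sum_distrib_left mult_ac)
  finally show ?thesis .
qed

section \<open>The weighted transport of a constant field\<close>

lemma continuous_matrix_vector: "continuous_on S f \<Longrightarrow> continuous_on S (\<lambda>x. A *v f x)"
  for A :: "real ^ 'n ^ 'm"
  by (rule bounded_linear.continuous_on[OF matrix_vector_mul_bounded_linear])

lemma (in pos_def_matrix) GDERIV_inverse_q_power:
  assumes "x \<noteq> 0"
  shows "GDERIV (\<lambda>x. inverse (q x) ^ m) x :> (- 2 * real m * inverse (q x) ^ (m + 1)) *\<^sub>R (A *v x)"
proof -
  have "GDERIV q x :> 2 *\<^sub>R (A *v x)"
    unfolding gderiv_def using q_has_derivative[of x UNIV] by (simp add: inner_commute)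
  moreover have "DERIV (\<lambda>s. inverse s ^ m) (q x) :> - (real m * inverse (q x) ^ (m + 1))"
  proof -
    have "DERIV (\<lambda>s. inverse s ^ m) (q x)
        :> of_nat m * (- (inverse (q x) ^ Suc (Suc 0)) * inverse (q x) ^ (m - Suc 0))"
      using assms by (intro DERIV_power DERIV_inverse) simp
    \<comment> \<open>For \<open>m = 0\<close> the truncated exponent \<open>m - Suc 0\<close> is
      harmless because the factor \<open>m\<close> vanishes.\<close>
    then show ?thesis
      by (cases m) (simp_all add: mult_ac)
  qed
  ultimately have "GDERIV (\<lambda>x. inverse (q x) ^ m) x :> (- (real m * inverse (q x) ^ (m + 1))) *\<^sub>R 2 *\<^sub>R (A *v x)"
    by (rule GDERIV_DERIV_compose)
  then show ?thesis
    by (simp add: mult_ac)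
qed

context pos_def_matrix
begin

interpretation inv: pos_def_matrix "matrix_inv A"
  by (rule pos_def_matrix_inv)

text \<open>Up to a constant factor, the Piola transform of the constant field \<open>e\<close>
  under \<open>T\<close>. It is written in the variable \<open>x = T y\<close>, where
  \<open>q y\<close> becomes \<open>inverse (inv.q x)\<close>, so that it can be differentiated
  directly.\<close>

definition W :: "real ^ 'n \<Rightarrow> real ^ 'n \<Rightarrow> real ^ 'n"
  where "W e x = inverse (inv.q x) ^ (CARD('n) - 1) *\<^sub>R (A *v e)
    - (2 * (inverse (inv.q x) ^ CARD('n) * (x \<bullet> e))) *\<^sub>R x"

lemma W_T:
  assumes "y \<noteq> 0"
  shows "W e (T y) = q y ^ CARD('n) *\<^sub>R DT y e"
proof -
  have "q y ^ CARD('n) = q y * q y ^ (CARD('n) - 1)"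
    by (simp flip: power_Suc)
  then show ?thesis
    using assms unfolding W_def inv_q_T
    by (simp add: DT_def T_def scaleR_diff_right power2_eq_square field_simps)
qed

text \<open>The gradient of the component of \<open>W e\<close> along \<open>b\<close>, as the
  product rule yields it. The exponent \<open>CARD('n)\<close> in the first term is that of the
  weight, \<open>CARD('n) - 1\<close>, raised by one.\<close>

definition W' :: "real ^ 'n \<Rightarrow> real ^ 'n \<Rightarrow> real ^ 'n \<Rightarrow> real ^ 'n"
  where "W' e b x =
    ((A *v e) \<bullet> b * (- 2 * real (CARD('n) - 1) * inverse (inv.q x) ^ CARD('n))) *\<^sub>R (matrix_inv A *v x)
    - 2 *\<^sub>R (inverse (inv.q x) ^ CARD('n) *\<^sub>R ((x \<bullet> e) *\<^sub>R b + (x \<bullet> b) *\<^sub>R e)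
       + ((x \<bullet> e) * (x \<bullet> b) * (- 2 * real CARD('n) * inverse (inv.q x) ^ (CARD('n) + 1))) *\<^sub>R (matrix_inv A *v x))"

lemma GDERIV_W:
  assumes "x \<noteq> 0"
  shows "GDERIV (\<lambda>x. W e x \<bullet> b) x :> W' e b x"
proof -
  have lin: "GDERIV (\<lambda>x. x \<bullet> v) x :> v" for v
    unfolding gderiv_def by (auto intro!: derivative_eq_intros)
  note p = inv.GDERIV_inverse_q_power[OF assms]
  have "GDERIV (\<lambda>x. inverse (inv.q x) ^ (CARD('n) - 1) * ((A *v e) \<bullet> b)
      - 2 * (inverse (inv.q x) ^ CARD('n) * ((x \<bullet> e) * (x \<bullet> b)))) x :> W' e b x"
    by (rule GDERIV_subst[OF GDERIV_diff[OF GDERIV_mult[OF p GDERIV_const]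
          GDERIV_mult[OF GDERIV_const GDERIV_mult[OF p GDERIV_mult[OF lin lin]]]]])
      (simp add: W'_def)
  then show ?thesis
    by (simp add: W_def inner_diff_left mult.assoc)
qed

lemma continuous_W': "continuous_on (- {0}) (W' e b)"
  unfolding W'_def
  by (intro continuous_intros inv.continuous_q continuous_matrix_vector) auto

text \<open>The Piola identity by computation. In units of \<open>?p ^ ?N\<close> times the pairing
  of \<open>x\<close> and \<open>e\<close>, the first term of \<open>W'\<close> contributes -2(N -
  1), the symmetric product term -2(N + 1) and the derivative of the last weight 4N, which add up to
  0.\<close>

lemma div_W:
  assumes "x \<noteq> 0"
  shows "(\<Sum>b\<in>Basis. W' e b x \<bullet> b) = 0"
proof -
  let ?p = "inverse (inv.q x)" and ?N = "CARD('n)" and ?B = "matrix_inv A"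
  have sums: "(\<Sum>b\<in>Basis. (v \<bullet> b) * (w \<bullet> b)) = v \<bullet> w" for v w :: "real ^ 'n"
    by (rule euclidean_inner[symmetric])
  have "W' e b x \<bullet> b = (- 2 * real (?N - 1) * ?p ^ ?N) * (((A *v e) \<bullet> b) * ((?B *v x) \<bullet> b))
     - 2 * (?p ^ ?N * ((x \<bullet> e) * (b \<bullet> b) + (x \<bullet> b) * (e \<bullet> b))
       + (x \<bullet> e) * (- 2 * real ?N * ?p ^ (?N + 1)) * ((x \<bullet> b) * ((?B *v x) \<bullet> b)))" for b
    by (simp add: W'_def inner_diff_left inner_add_left mult_ac)
  then have "(\<Sum>b\<in>Basis. W' e b x \<bullet> b)
      = (- 2 * real (?N - 1) * ?p ^ ?N) * ((A *v e) \<bullet> (?B *v x))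
       - 2 * (?p ^ ?N * ((x \<bullet> e) * real ?N + x \<bullet> e)
       + (x \<bullet> e) * (- 2 * real ?N * ?p ^ (?N + 1)) * (x \<bullet> (?B *v x)))"
    by (simp only: sum_subtractf sum.distrib sums flip: sum_distrib_left) simp
  moreover have "(A *v e) \<bullet> (?B *v x) = x \<bullet> e"
    by (simp add: sym_inner inv_vec inner_commute)
  \<comment> \<open>Here \<open>x\<close> paired with \<open>?B *v x\<close> is
    \<open>inv.q x\<close>, which absorbs one factor \<open>?p\<close>.\<close>
  moreover have "(x \<bullet> e) * (- 2 * real ?N * ?p ^ (?N + 1)) * (x \<bullet> (?B *v x)) = - 2 * real ?N * (?p ^ ?N * (x \<bullet> e))"
    using assms by (simp add: inv.q_def[symmetric] inner_commute[of x])
  moreover have "real (?N - 1) = real ?N - 1"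
    by simp
  ultimately show ?thesis
    by (simp only:) (simp add: algebra_simps)
qed

section \<open>Test functions and gradients under \<open>T\<close>\<close>

text \<open>The chain rule transports gradients by the adjoint of the derivative, which is
  \<open>DT y\<close> itself by \<open>DT_sym\<close>.\<close>

lemma GDERIV_comp_T:
  assumes "GDERIV \<psi> (T y) :> D" "y \<noteq> 0"
  shows "GDERIV (\<lambda>y. \<psi> (T y)) y :> DT y D"
  using has_derivative_compose[OF T_has_derivative[OF assms(2)] assms(1)[unfolded gderiv_def]]
  by (simp add: gderiv_def DT_sym)

lemma continuous_DT:
  assumes "continuous_on (- {0}) f"
  shows "continuous_on (- {0}) (\<lambda>x. DT x (f x))"
  unfolding DT_def
  by (intro continuous_intros continuous_q continuous_matrix_vector assms) auto

text \<open>The support moves to its image under the inverse map, compact because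
  \<open>inv.T\<close> is continuous off the origin.\<close>

lemma C1_comp_T:
  assumes \<phi>: "\<phi> \<in> C1_compact_support (- {0})"
  shows "(\<lambda>y. \<phi> (T y)) \<in> C1_compact_support (- {0})"
proof -
  obtain K where K: "compact K" "K \<subseteq> - {0}" and zero: "\<And>x. x \<notin> K \<Longrightarrow> \<phi> x = 0"
    and "\<And>x. x \<notin> K \<Longrightarrow> grad \<phi> x = 0"
    by (rule C1_compact_supportE[OF \<phi>]) (rule that)
  show ?thesis
  proof (rule C1_compact_supportI)
    show "compact (inv.T ` K)"
      using K inv.continuous_T by (meson compact_continuous_image continuous_on_subset)
    show "inv.T ` K \<subseteq> - {0}"
      using K by auto
    show "\<phi> (T y) = 0" if "y \<notin> inv.T ` K" for y
      using that zero by (metis imageI inv_T_T)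
    show "GDERIV (\<lambda>y. \<phi> (T y)) y :> DT y (grad \<phi> (T y))" if "y \<in> - {0}" for y
      using that by (intro GDERIV_comp_T GDERIV_grad[OF \<phi>]) auto
    show "continuous_on (- {0}) (\<lambda>y. DT y (grad \<phi> (T y)))"
      by (intro continuous_DT continuous_on_compose2[OF C1_continuous_grad[OF \<phi>, of UNIV] continuous_T]) auto
  qed auto
qed

text \<open>The operator norm of \<open>DT x\<close> is bounded by a weight that is continuous off
  the origin.\<close>

lemma Lp_loc_DT:
  assumes "G \<in> Lp_loc p (- {0})" "p \<ge> 0"
  shows "(\<lambda>y. DT y (G y)) \<in> Lp_loc p (- {0})"
proof (rule Lp_loc_bound[OF assms])
  define w where "w x = onorm ((*v) A) / q x + 2 * norm (A *v x) * norm (A *v x) / (q x)\<^sup>2" for x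
  show "continuous_on (- {0}) w"
    unfolding w_def by (intro continuous_intros continuous_q continuous_matrix_vector) auto
  fix x :: "real ^ 'n" assume "x \<in> - {0}"
  then have "q x > 0"
    by (simp add: q_pos)
  have 1: "norm (A *v v) \<le> onorm ((*v) A) * norm v" for v
    by (rule onorm) simp
  have 2: "\<bar>(A *v x) \<bullet> v\<bar> \<le> norm (A *v x) * norm v" for v
    by (rule Cauchy_Schwarz_ineq2)
  have "norm (DT x (G x)) \<le> norm ((A *v G x) /\<^sub>R q x) + norm ((2 * ((A *v x) \<bullet> G x) / (q x)\<^sup>2) *\<^sub>R (A *v x))"
    unfolding DT_def by (rule norm_triangle_ineq4)
  also have "\<dots> = norm (A *v G x) / q x + 2 * \<bar>(A *v x) \<bullet> G x\<bar> * norm (A *v x) / (q x)\<^sup>2"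
    using \<open>q x > 0\<close> by (simp add: abs_mult divide_inverse)
  also have "\<dots> \<le> (onorm ((*v) A) * norm (G x)) / q x + 2 * (norm (A *v x) * norm (G x)) * norm (A *v x) / (q x)\<^sup>2"
    using 1 2 \<open>q x > 0\<close> by (intro add_mono divide_right_mono mult_right_mono mult_left_mono) auto
  also have "\<dots> = w x * norm (G x)"
    by (simp add: w_def algebra_simps)
  finally show "norm (DT x (G x)) \<le> w x * norm (G x)" .
next
  have G: "G \<in> borel_measurable (lebesgue_on (- {0}))"
    using assms by (simp add: Lp_loc_def)
  have AG: "(\<lambda>y. A *v G y) \<in> borel_measurable (lebesgue_on (- {0}))"
    by (rule measurable_compose[OF G])
      (intro borel_measurable_continuous_onI continuous_matrix_vector continuous_on_id)
  have c: "f \<in> borel_measurable (lebesgue_on (- {0}))" if "continuous_on (- {0}) f" for f :: "real ^ 'n \<Rightarrow> 'c::euclidean_space"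
    using that by (rule continuous_imp_measurable_on_sets_lebesgue) auto
  have "q \<in> borel_measurable (lebesgue_on (- {0}))" "(\<lambda>y. A *v y) \<in> borel_measurable (lebesgue_on (- {0}))"
    by (intro c continuous_q continuous_matrix_vector continuous_intros)+
  then show "(\<lambda>y. DT y (G y)) \<in> borel_measurable (lebesgue_on (- {0}))"
    unfolding DT_def using G AG by measurable
qed auto

end

section \<open>Transport of weak gradients and of the equation\<close>

context pos_def_matrix
begin

interpretation inv: pos_def_matrix "matrix_inv A"
  by (rule pos_def_matrix_inv)

text \<open>Composition with \<open>inv.T\<close> preserves test functions too, so every test
  function off the origin is a pull-back under \<open>T\<close>.\<close>

lemma C1_transfer_T:
  assumes \<phi>: "\<phi> \<in> C1_compact_support (- {0})"
  obtains \<psi> where "\<psi> \<in> C1_compact_support (- {0})" "\<And>y. \<phi> y = \<psi> (T y)"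
    "\<And>y. y \<noteq> 0 \<Longrightarrow> grad \<phi> y = DT y (grad \<psi> (T y))"
proof
  let ?\<psi> = "\<lambda>x. \<phi> (inv.T x)"
  show \<psi>: "?\<psi> \<in> C1_compact_support (- {0})"
    by (rule inv.C1_comp_T[OF \<phi>])
  show "\<phi> y = ?\<psi> (T y)" for y
    by simp
  show "grad \<phi> y = DT y (grad ?\<psi> (T y))" if "y \<noteq> 0" for y
    using GDERIV_comp_T[OF GDERIV_grad[OF \<psi>] that] by (simp add: grad_eq)
qed

lemma set_integral_T':
  "(LINT x:- {0}|lebesgue. f (T x) / q x ^ CARD('n)) = (LINT x:- {0}|lebesgue. f x) / \<bar>det A\<bar>"
  using set_integral_T[of "- {0}" f] by (simp add: T_image)

lemma has_weak_gradient_T: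
  assumes wg: "has_weak_gradient UNIV u G"
  shows "has_weak_gradient (- {0}) (\<lambda>y. u (T y)) (\<lambda>y. DT y (G (T y)))"
  unfolding has_weak_gradient_def
proof (intro conjI ballI)
  have opn: "open (- {0 :: real ^ 'n})"
    by auto
  show uT: "(\<lambda>y. u (T y)) \<in> Lp_loc 1 (- {0})"
    using wg by (intro Lp_loc_T) (auto simp: has_weak_gradient_def)
  show GT: "(\<lambda>y. DT y (G (T y))) \<in> Lp_loc 1 (- {0})"
    using wg by (intro Lp_loc_DT Lp_loc_T) (auto simp: has_weak_gradient_def)
  fix \<phi> assume \<phi>: "\<phi> \<in> C1_compact_support (- {0 :: real ^ 'n})"
  obtain K where K: "compact K" "K \<subseteq> - {0}"
    and zero: "\<And>x. x \<notin> K \<Longrightarrow> \<phi> x = 0" "\<And>x. x \<notin> K \<Longrightarrow> grad \<phi> x = 0"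
    by (rule C1_compact_supportE[OF \<phi>]) (rule that)
  obtain \<psi> where \<psi>: "\<psi> \<in> C1_compact_support (- {0})" "\<And>y. \<phi> y = \<psi> (T y)"
    "\<And>y. y \<noteq> 0 \<Longrightarrow> grad \<phi> y = DT y (grad \<psi> (T y))"
    by (rule C1_transfer_T[OF \<phi>]) (rule that)
  have int1: "set_integrable lebesgue (- {0}) (\<lambda>y. u (T y) *\<^sub>R grad \<phi> y)"
    by (rule set_integrable_scaleR_continuous[OF opn K uT C1_continuous_grad[OF \<phi>]]) (simp add: zero)
  have int2: "set_integrable lebesgue (- {0}) (\<lambda>y. \<phi> y *\<^sub>R DT y (G (T y)))"
    by (rule set_integrable_continuous_scaleR[OF opn K GT C1_continuous[OF \<phi>]]) (simp add: zero)
  show "(LINT y:- {0}|lebesgue. u (T y) *\<^sub>R grad \<phi> y) = - (LINT y:- {0}|lebesgue. \<phi> y *\<^sub>R DT y (G (T y)))"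
  proof (rule euclidean_eqI)
    fix e :: "real ^ 'n"
    have "(LINT y:- {0}|lebesgue. u (T y) *\<^sub>R grad \<phi> y) \<bullet> e = (LINT y:- {0}|lebesgue. (u (T y) *\<^sub>R grad \<phi> y) \<bullet> e)"
      by (rule set_integral_inner(2)[OF int1, symmetric])
    \<comment> \<open>By symmetry \<open>DT y\<close> moves from \<open>grad \<psi>\<close> to
      \<open>e\<close>, where \<open>W_T\<close> turns it into \<open>W e\<close> together with the
      Jacobian weight.\<close>
    also have "\<dots> = (LINT y:- {0}|lebesgue. u (T y) * (grad \<psi> (T y) \<bullet> W e (T y)) / q y ^ CARD('n))"
      by (intro set_lebesgue_integral_cong) (auto simp: W_T \<psi>(3) DT_sym)
    also have "\<dots> = (LINT x:- {0}|lebesgue. u x * (grad \<psi> x \<bullet> W e x)) / \<bar>det A\<bar>"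
      by (rule set_integral_T'[of "\<lambda>x. u x * (grad \<psi> x \<bullet> W e x)"])
    \<comment> \<open>Integration by parts against \<open>W e\<close>, carried out off the origin,
      where this field is differentiable and divergence free.\<close>
    also have "(LINT x:- {0}|lebesgue. u x * (grad \<psi> x \<bullet> W e x)) = - (LINT x:- {0}|lebesgue. \<psi> x * (G x \<bullet> W e x))"
      using has_weak_gradient_subset[OF wg, of "- {0}"]
      by (intro weak_gradient_divergence_free[OF opn _ \<psi>(1), where V' = "W' e"] GDERIV_W continuous_W' div_W) auto
    \<comment> \<open>The change of variables is now undone, which cancels the determinant.\<close>
    also have "- (LINT x:- {0}|lebesgue. \<psi> x * (G x \<bullet> W e x)) / \<bar>det A\<bar>
        = - (LINT y:- {0}|lebesgue. \<psi> (T y) * (G (T y) \<bullet> W e (T y)) / q y ^ CARD('n))"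
      by (simp add: set_integral_T'[of "\<lambda>x. \<psi> x * (G x \<bullet> W e x)"])
    also have "(LINT y:- {0}|lebesgue. \<psi> (T y) * (G (T y) \<bullet> W e (T y)) / q y ^ CARD('n))
        = (LINT y:- {0}|lebesgue. (\<phi> y *\<^sub>R DT y (G (T y))) \<bullet> e)"
      by (intro set_lebesgue_integral_cong) (auto simp: W_T \<psi>(2) DT_sym)
    also have "\<dots> = (LINT y:- {0}|lebesgue. \<phi> y *\<^sub>R DT y (G (T y))) \<bullet> e"
      by (rule set_integral_inner(2)[OF int2])
    finally show "(LINT y:- {0}|lebesgue. u (T y) *\<^sub>R grad \<phi> y) \<bullet> e
        = (- (LINT y:- {0}|lebesgue. \<phi> y *\<^sub>R DT y (G (T y)))) \<bullet> e"
      by simp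
  qed
qed

text \<open>By \<open>DT_conj\<close> the dual norm of \<open>DT y v\<close> is the norm of
  \<open>v\<close> over \<open>q y\<close>. Its power \<open>CARD('n) - 2\<close> and the remaining
  pairing, which contributes the inverse square of \<open>q y\<close>, combine to the full Jacobian
  weight: conformal invariance in dimension N.\<close>

lemma finsler_flux_DT:
  assumes "CARD('n) \<ge> 2"
  shows "finsler_flux (quad_norm (matrix_inv A)) (DT y v) \<bullet> DT y w
    = finsler_flux (quad_norm A) v \<bullet> w / q y ^ CARD('n)"
proof -
  have "inv.q (DT y v) = q v / (q y)\<^sup>2"
    unfolding inv.q_def DT_conj q_def ..
  then have "quad_norm (matrix_inv A) (DT y v) = quad_norm A v / q y"
    using q_nonneg by (simp add: inv.quad_norm_eq quad_norm_eq real_sqrt_divide)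
  moreover have "q y ^ CARD('n) = q y ^ (CARD('n) - 2) * (q y)\<^sup>2"
    using assms by (simp only: power_add[symmetric] le_add_diff_inverse2)
  ultimately show ?thesis
    using assms
    by (simp add: finsler_flux_quad_norm inv.finsler_flux_quad_norm DT_conj power_divide)
qed

text \<open>Both sides of the equation acquire the same Jacobian weight, the left one by
  conformality and the right one through the new source term.\<close>

theorem weak_solution_T:
  assumes "CARD('n) \<ge> 2" and u: "weak_solution (quad_norm A) UNIV g u"
  shows "weak_solution (quad_norm (matrix_inv A)) (- {0}) (\<lambda>y. g (T y) / q y ^ CARD('n)) (\<lambda>y. u (T y))"
proof -
  let ?N = "CARD('n)"
  obtain G where wg: "has_weak_gradient UNIV u G" and G: "G \<in> Lp_loc (real ?N) UNIV"
    and eq: "\<And>\<phi>. \<phi> \<in> C1_compact_support UNIV \<Longrightarrow>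
      (LINT x|lebesgue. finsler_flux (quad_norm A) (G x) \<bullet> grad \<phi> x) = (LINT x|lebesgue. g x * \<phi> x)"
    using u by (auto simp: weak_solution_def set_lebesgue_integral_def)
  have g: "g \<in> Lp_loc (real ?N / (real ?N - 1)) UNIV" and u': "u \<in> Lp_loc (real ?N) UNIV"
    using u by (auto simp: weak_solution_def W1p_loc_def)
  let ?G = "\<lambda>y. DT y (G (T y))"
  have wgT: "has_weak_gradient (- {0}) (\<lambda>y. u (T y)) ?G"
    by (rule has_weak_gradient_T[OF wg])
  have GT: "?G \<in> Lp_loc (real ?N) (- {0})"
    using G by (intro Lp_loc_DT Lp_loc_T) auto
  have uT: "(\<lambda>y. u (T y)) \<in> Lp_loc (real ?N) (- {0})"
    using u' by (intro Lp_loc_T) auto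
  have gT: "(\<lambda>y. g (T y)) \<in> Lp_loc (real ?N / (real ?N - 1)) (- {0})"
    using g assms(1) by (intro Lp_loc_T) auto
  have cont: "continuous_on (- {0}) (\<lambda>y. 1 / q y ^ ?N)"
    by (intro continuous_intros continuous_q) auto
  have hT: "(\<lambda>y. g (T y) / q y ^ ?N) \<in> Lp_loc (real ?N / (real ?N - 1)) (- {0})"
  proof (rule Lp_loc_bound[OF gT _ _ _ cont])
    have "(\<lambda>y. 1 / q y ^ ?N) \<in> borel_measurable (lebesgue_on (- {0}))"
      using cont by (rule continuous_imp_measurable_on_sets_lebesgue) auto
    moreover have "(\<lambda>y. g (T y)) \<in> borel_measurable (lebesgue_on (- {0}))"
      using gT by (simp add: Lp_loc_def)
    ultimately have "(\<lambda>y. g (T y) * (1 / q y ^ ?N)) \<in> borel_measurable (lebesgue_on (- {0}))"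
      by (intro borel_measurable_times)
    then show "(\<lambda>y. g (T y) / q y ^ ?N) \<in> borel_measurable (lebesgue_on (- {0}))"
      by simp
    show "norm (g (T y) / q y ^ ?N) \<le> 1 / q y ^ ?N * norm (g (T y))" for y
      using q_nonneg[of y] by simp
  qed (use assms(1) in auto)
  have "(LINT y:- {0}|lebesgue. finsler_flux (quad_norm (matrix_inv A)) (?G y) \<bullet> grad \<phi> y)
      = (LINT y:- {0}|lebesgue. g (T y) / q y ^ ?N * \<phi> y)"
    if \<phi>: "\<phi> \<in> C1_compact_support (- {0})" for \<phi>
  proof -
    obtain \<psi> where \<psi>: "\<psi> \<in> C1_compact_support (- {0})" "\<And>y. \<phi> y = \<psi> (T y)"
      "\<And>y. y \<noteq> 0 \<Longrightarrow> grad \<phi> y = DT y (grad \<psi> (T y))"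
      by (rule C1_transfer_T[OF \<phi>]) (rule that)
    obtain K where K: "compact K" "K \<subseteq> - {0}"
      and zero: "\<And>x. x \<notin> K \<Longrightarrow> \<psi> x = 0" "\<And>x. x \<notin> K \<Longrightarrow> grad \<psi> x = 0"
      by (rule C1_compact_supportE[OF \<psi>(1)]) (rule that)
    \<comment> \<open>\<open>\<psi>\<close> is supported off the origin, so it also tests the
      equation for \<open>u\<close>, and integrals over the whole and the punctured space
      agree.\<close>
    have 0: "\<psi> 0 = 0" "grad \<psi> 0 = 0"
      using K by (auto intro: zero)
    have restrict: "(LINT x|lebesgue. f x) = (LINT x:- {0}|lebesgue. f x)" if "f 0 = 0" for f :: "real ^ 'n \<Rightarrow> real"
      using set_integral_zero_outside[of "- {0}" UNIV f] that by (simp add: set_lebesgue_integral_def)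
    have "(LINT y:- {0}|lebesgue. finsler_flux (quad_norm (matrix_inv A)) (?G y) \<bullet> grad \<phi> y)
        = (LINT y:- {0}|lebesgue. (finsler_flux (quad_norm A) (G (T y)) \<bullet> grad \<psi> (T y)) / q y ^ ?N)"
      by (intro set_lebesgue_integral_cong) (auto simp: \<psi>(3) finsler_flux_DT[OF assms(1)])
    also have "\<dots> = (LINT x:- {0}|lebesgue. finsler_flux (quad_norm A) (G x) \<bullet> grad \<psi> x) / \<bar>det A\<bar>"
      by (rule set_integral_T'[of "\<lambda>x. finsler_flux (quad_norm A) (G x) \<bullet> grad \<psi> x"])
    also have "(LINT x:- {0}|lebesgue. finsler_flux (quad_norm A) (G x) \<bullet> grad \<psi> x)
        = (LINT x|lebesgue. finsler_flux (quad_norm A) (G x) \<bullet> grad \<psi> x)"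
      by (rule restrict[symmetric]) (simp add: 0)
    also have "\<dots> = (LINT x|lebesgue. g x * \<psi> x)"
      using \<psi>(1) C1_compact_support_subset by (intro eq) blast
    also have "\<dots> = (LINT x:- {0}|lebesgue. g x * \<psi> x)"
      by (rule restrict) (simp add: 0)
    also have "\<dots> / \<bar>det A\<bar> = (LINT y:- {0}|lebesgue. g (T y) * \<psi> (T y) / q y ^ ?N)"
      by (rule set_integral_T'[of "\<lambda>x. g x * \<psi> x", symmetric])
    also have "\<dots> = (LINT y:- {0}|lebesgue. g (T y) / q y ^ ?N * \<phi> y)"
      by (simp add: \<psi>(2))
    finally show ?thesis .
  qed
  then show ?thesis
    using wgT GT uT hT unfolding weak_solution_def W1p_loc_def by auto
qed

end

theorem theorem1p4:
  fixes M :: "real^'n^'n" and H :: "real^'n \<Rightarrow> real" and g u :: "real^'n \<Rightarrow> real"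
  assumes "CARD('n) \<ge> 3"
    and "transpose M = M"
    and "\<And>x. x \<noteq> 0 \<Longrightarrow> (M *v x) \<bullet> x > 0"
    and "\<And>\<xi>. H \<xi> = sqrt ((M *v \<xi>) \<bullet> \<xi>)"
    and "g \<in> Lp_loc (real CARD('n) / (real CARD('n) - 1)) UNIV"
    and "u \<in> W1p_loc (real CARD('n)) UNIV"
    and "locally_bounded UNIV u"
    and "weak_solution H UNIV g u"
  shows "weak_solution (dual_norm H) (- {0})
           (\<lambda>y. g (T_map H y) / H y ^ (2 * CARD('n))) (u \<circ> T_map H)"
proof -
  interpret pos_def_matrix M
    using assms(2,3) by unfold_locales
  have H: "H = quad_norm M"
    using assms(4) by (simp add: quad_norm_def fun_eq_iff)
  have "H y ^ (2 * CARD('n)) = q y ^ CARD('n)" for y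
    by (simp add: H power_mult quad_norm_sq)
  then show ?thesis
    using weak_solution_T[of g u] assms(1,8)
    by (simp add: H dual_norm_quad_norm T_map_quad_norm comp_def)
qed

end
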